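(* Let $G=(V,E)$ be a graph. The following are equivalent: (1) $G$ is chordal; (2) $\mathcal{P}(G)$ is binary; (3) $\mathcal{P}(G)$ is bounded.
   Context: All graphs are finite and simple. A graph is chordal if it has no induced cycle of length at least 4. A clique is a set of pairwise adjacent vertices (the empty set is allowed). $N(w)$ is the set of neighbors of $w$. For $U\subseteq V$, $C(U)$ is the set of vertices not in $U$ adjacent to every vertex of $U$. For $w\in V$ and $U\subseteq V$, $\delta(w,U)$ is the set of edges joining $w$ to a vertex of $U$, and $y(F)=\sum_{e\in F}y_e$ for $F\subseteq E$. $\mathcal{C}_P(G)$ is the cone of all $(x,y)\in\mathbb{R}^V\times\mathbb{R}^E$ satisfying $$y\bigl(\delta(w,C(K\cup\{w\}))\bigr)+2\,y\bigl(\delta(w,K)\bigr)\le 2x_w\quad\forall w\in V,\ \text{cliques }K\subseteq N(w);$$ $$x_w\ge 0\quad\forall w\in V;\qquad y_e\ge 0\quad\forall e\in E.$$ $\mathcal{P}(G)$ is the intersection of $\mathcal{C}_P(G)$ with the hyperplane $\{(x,y):\sum_{v\in V}x_v-\sum_{e\in E}y_e=1\}$. A polyhedron is called binary if it is a polytope (i.e. it is bounded) and all its extreme points have all coordinates in $\{0,1\}$. *)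

theory Defs
  imports "HOL-Analysis.Analysis"
begin

text \<open>A graph is given by its vertex set \<open>V\<close> and its edge set \<open>E\<close>, edges being two-element
  subsets of \<open>V\<close>. The vertex set may be empty.\<close>

definition simple_graph :: "'a set \<Rightarrow> 'a set set \<Rightarrow> bool" where
  "simple_graph V E \<longleftrightarrow> finite V \<and> (\<forall>e\<in>E. e \<subseteq> V \<and> card e = 2)"

text \<open>The distinct vertices listed by \<open>c\<close> induce, in this cyclic order, a cycle of length
  \<open>length c\<close>: the edges among them are exactly those joining cyclically consecutive ones.\<close>

definition induced_cycle :: "'a set \<Rightarrow> 'a set set \<Rightarrow> 'a list \<Rightarrow> bool" where
  "induced_cycle V E c \<longleftrightarrow>
     length c \<ge> 3 \<and> distinct c \<and> set c \<subseteq> V \<and>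
     (\<forall>i<length c. \<forall>j<length c.
        {c ! i, c ! j} \<in> E \<longleftrightarrow> j = Suc i mod length c \<or> i = Suc j mod length c)"

definition chordal :: "'a set \<Rightarrow> 'a set set \<Rightarrow> bool" where
  "chordal V E \<longleftrightarrow> \<not> (\<exists>c. induced_cycle V E c \<and> length c \<ge> 4)"

definition clique :: "'a set \<Rightarrow> 'a set set \<Rightarrow> 'a set \<Rightarrow> bool" where
  "clique V E K \<longleftrightarrow> K \<subseteq> V \<and> (\<forall>u\<in>K. \<forall>v\<in>K. u \<noteq> v \<longrightarrow> {u, v} \<in> E)"

definition neighbors :: "'a set \<Rightarrow> 'a set set \<Rightarrow> 'a \<Rightarrow> 'a set" where
  "neighbors V E w = {v \<in> V. {w, v} \<in> E}"

definition common_neighbors :: "'a set \<Rightarrow> 'a set set \<Rightarrow> 'a set \<Rightarrow> 'a set" where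
  "common_neighbors V E U = {v \<in> V - U. \<forall>u\<in>U. {u, v} \<in> E}"

definition edges_to :: "'a set set \<Rightarrow> 'a \<Rightarrow> 'a set \<Rightarrow> 'a set set" where
  "edges_to E w U = {e \<in> E. \<exists>u\<in>U. e = {w, u}}"

text \<open>The space of pairs of a vertex vector and an edge vector of the graph is represented as the
  coordinate subspace of \<open>(real ^ 'a) \<times> (real ^ ('a set))\<close> in which all coordinates not indexed by
  a vertex in \<open>V\<close> or an edge in \<open>E\<close> vanish. Boundedness and extreme points are the same in the
  subspace and in the ambient space.\<close>

definition graph_space ::
    "'a::finite set \<Rightarrow> 'a set set \<Rightarrow> ((real ^ 'a) \<times> (real ^ ('a set))) set" where
  "graph_space V E = {(x, y). (\<forall>v. v \<notin> V \<longrightarrow> x $ v = 0) \<and> (\<forall>e. e \<notin> E \<longrightarrow> y $ e = 0)}"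

definition cone_P ::
    "'a::finite set \<Rightarrow> 'a set set \<Rightarrow> ((real ^ 'a) \<times> (real ^ ('a set))) set" where
  "cone_P V E = {(x, y). (x, y) \<in> graph_space V E \<and>
     (\<forall>w\<in>V. \<forall>K. clique V E K \<and> K \<subseteq> neighbors V E w \<longrightarrow>
        (\<Sum>e\<in>edges_to E w (common_neighbors V E (K \<union> {w})). y $ e)
          + 2 * (\<Sum>e\<in>edges_to E w K. y $ e) \<le> 2 * x $ w) \<and>
     (\<forall>w\<in>V. x $ w \<ge> 0) \<and> (\<forall>e\<in>E. y $ e \<ge> 0)}"

definition graph_polyhedron ::
    "'a::finite set \<Rightarrow> 'a set set \<Rightarrow> ((real ^ 'a) \<times> (real ^ ('a set))) set" where
  "graph_polyhedron V E =
     cone_P V E \<inter> {(x, y). (\<Sum>v\<in>V. x $ v) - (\<Sum>e\<in>E. y $ e) = 1}"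

text \<open>On subsets of \<open>graph_space V E\<close>, the condition on the additional coordinates holds
  trivially, since these are zero.\<close>

definition binary_polyhedron :: "((real ^ 'i::finite) \<times> (real ^ 'j::finite)) set \<Rightarrow> bool" where
  "binary_polyhedron P \<longleftrightarrow> polytope P \<and>
     (\<forall>x y. (x, y) extreme_point_of P \<longrightarrow> (\<forall>i. x $ i \<in> {0, 1}) \<and> (\<forall>j. y $ j \<in> {0, 1}))"

end

theory Submission
  imports Defs
begin

text \<open>For fixed \<open>w\<close>, the inequalities of the cone are the covering conditions dual to fractional matching
  in the complement of the graph on the neighbours of \<open>w\<close>, where a neighbour \<open>u\<close> has capacity
  \<open>y\<^sub>w\<^sub>u\<close>. They hold for all cliques \<open>K\<close> iff the edge weight at \<open>w\<close> can be split into transitions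
  \<open>u - w - v\<close> through \<open>w\<close>, with \<open>u\<close> and \<open>v\<close> nonadjacent, and path ends at \<open>w\<close>, of total weight at
  most \<open>x\<^sub>w\<close>. Following transitions gives walks whose consecutive triples are induced; in a
  chordal graph such a walk is an induced path. Hence a point of the cone is a nonnegative combination
  of vectors of induced paths, and these satisfy the equation of the hyperplane, so that the
  polyhedron is their convex hull. Conversely the vector of an induced cycle of length at least 4 lies in
  the cone and is a direction of recession of the polyhedron.\<close>

section \<open>Induced paths and cycles\<close>

definition nbrs_in :: "'a set set \<Rightarrow> 'a set \<Rightarrow> 'a \<Rightarrow> 'a set" where
  "nbrs_in E U w = {u\<in>U. {w, u} \<in> E}"

definition induced_vec :: "'a::finite set set \<Rightarrow> 'a set \<Rightarrow> (real ^ 'a) \<times> (real ^ ('a set))" where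
  "induced_vec E U =
     (\<chi> v. if v \<in> U then 1 else 0, \<chi> e. if e \<in> E \<and> e \<subseteq> U then 1 else 0)"

text \<open>In a simple graph these sets induce disjoint unions of paths and cycles of length at
  least 4. The conditions are local, like the inequalities of the cone, and suffice for membership
  there.\<close>

definition thin_sets :: "'a set \<Rightarrow> 'a set set \<Rightarrow> 'a set set" where
  "thin_sets V E = {U. U \<subseteq> V \<and> (\<forall>w\<in>U. card (nbrs_in E U w) \<le> 2) \<and>
     (\<forall>a\<in>U. \<forall>b\<in>U. \<forall>c\<in>U. \<not> ({a, b} \<in> E \<and> {b, c} \<in> E \<and> {a, c} \<in> E))}"

text \<open>Members of \<open>path_sets\<close> need not be connected: disjoint induced cycles may accompany a path.
  This is harmless, since only their vectors and the equation between the counts matter.\<close>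

definition path_sets :: "'a set \<Rightarrow> 'a set set \<Rightarrow> 'a set set" where
  "path_sets V E = {U \<in> thin_sets V E. card U = card {e\<in>E. e \<subseteq> U} + 1}"

definition induced_path :: "'a set \<Rightarrow> 'a set set \<Rightarrow> 'a list \<Rightarrow> bool" where
  "induced_path V E p \<longleftrightarrow> p \<noteq> [] \<and> distinct p \<and> set p \<subseteq> V \<and>
     (\<forall>i<length p. \<forall>j<length p. {p ! i, p ! j} \<in> E \<longleftrightarrow> j = Suc i \<or> i = Suc j)"

lemma no_loop: "simple_graph V E \<Longrightarrow> {v} \<notin> E"
  by (auto simp: simple_graph_def)

lemma edge_endpoints:
  assumes "simple_graph V E" "{u, v} \<in> E"
  shows "u \<in> V \<and> v \<in> V \<and> u \<noteq> v"
  using assms no_loop[OF assms(1)] by (auto simp: simple_graph_def)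

lemma sum_edges_to: "sum f (edges_to E w U) = (\<Sum>u\<in>nbrs_in E U w. f {w, u})"
proof -
  have "edges_to E w U = (\<lambda>u. {w, u}) ` nbrs_in E U w"
    by (auto simp: edges_to_def nbrs_in_def)
  moreover have "inj_on (\<lambda>u. {w, u}) (nbrs_in E U w)"
    by (auto simp: inj_on_def doubleton_eq_iff)
  ultimately show ?thesis by (simp add: sum.reindex)
qed

text \<open>At \<open>w\<close> outside \<open>U\<close> the left side vanishes. At \<open>w\<close>
  in \<open>U\<close>, with \<open>M\<close> its at most two neighbours in \<open>U\<close>, it is
  \<open>card (M \<inter> C) + 2 * card (M \<inter> K)\<close>. If \<open>K\<close> meets
  \<open>M\<close>, the absence of triangles leaves a single common vertex and makes
  \<open>C\<close> miss \<open>M\<close>, so the bound 2 persists.\<close>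

lemma induced_vec_in_cone_P:
  fixes V :: "'a::finite set"
  assumes sg: "simple_graph V E" and U: "U \<in> thin_sets V E"
  shows "induced_vec E U \<in> cone_P V E"
proof -
  have ineq: "(\<Sum>e\<in>edges_to E w (common_neighbors V E (K \<union> {w})). snd (induced_vec E U) $ e)
      + 2 * (\<Sum>e\<in>edges_to E w K. snd (induced_vec E U) $ e) \<le> 2 * fst (induced_vec E U) $ w"
    if K: "clique V E K" "K \<subseteq> neighbors V E w" for w K
  proof (cases "w \<in> U")
    case False
    then show ?thesis by (auto simp: induced_vec_def sum_edges_to)
  next
    case True
    define M where "M = nbrs_in E U w"
    define C where "C = common_neighbors V E (K \<union> {w})"
    have "(\<Sum>u\<in>nbrs_in E T w. snd (induced_vec E U) $ {w, u}) = real (card (M \<inter> T))" for T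
    proof -
      have "(\<Sum>u\<in>nbrs_in E T w. snd (induced_vec E U) $ {w, u}) =
        (\<Sum>u\<in>nbrs_in E T w. if u \<in> U then 1 else 0)"
        using True by (intro sum.cong) (auto simp: induced_vec_def nbrs_in_def)
      also have "\<dots> = real (card (nbrs_in E T w \<inter> U))"
        by (simp add: sum.If_cases)
      also have "nbrs_in E T w \<inter> U = M \<inter> T" by (auto simp: M_def nbrs_in_def)
      finally show ?thesis .
    qed
    moreover have "card (M \<inter> C) + 2 * card (M \<inter> K) \<le> 2"
    proof (cases "M \<inter> K = {}")
      case True
      have "card (M \<inter> C) \<le> card M" by (rule card_mono) auto
      also have "\<dots> \<le> 2" using U \<open>w \<in> U\<close> by (auto simp: thin_sets_def M_def)
      finally show ?thesis using True by simp
    next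
      case False
      then obtain k where k: "k \<in> M" "k \<in> K" by blast
      have tri: "\<not> ({w, a} \<in> E \<and> {a, b} \<in> E \<and> {w, b} \<in> E)" if "a \<in> M" "b \<in> M" for a b
        using U True that unfolding thin_sets_def M_def nbrs_in_def by blast
      have wM: "{w, a} \<in> E" if "a \<in> M" for a using that by (simp add: M_def nbrs_in_def)
      have "M \<inter> K = {k}"
        using k tri wM K unfolding clique_def by blast
      moreover have "M \<inter> C = {}"
        using k tri wM unfolding C_def common_neighbors_def by blast
      ultimately show ?thesis by simp
    qed
    ultimately show ?thesis
      using True by (simp add: sum_edges_to C_def induced_vec_def flip: of_nat_mult of_nat_add)
  qed
  have "U \<subseteq> V" using U by (auto simp: thin_sets_def)
  then show ?thesis
    using ineq by (auto simp: cone_P_def graph_space_def induced_vec_def)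
qed

text \<open>The quantity fixed by the hyperplane is vertices minus edges: 1 for an induced path, 0
  for an induced cycle of length at least 4.\<close>

lemma induced_vec_sum:
  fixes V :: "'a::finite set"
  assumes "U \<subseteq> V"
  shows "(\<Sum>v\<in>V. fst (induced_vec E U) $ v) - (\<Sum>e\<in>E. snd (induced_vec E U) $ e)
    = real (card U) - real (card {e\<in>E. e \<subseteq> U})"
proof -
  have "V \<inter> U = U" "E \<inter> {e. e \<subseteq> U} = {e\<in>E. e \<subseteq> U}" using assms by auto
  then show ?thesis by (simp add: induced_vec_def sum.If_cases)
qed

lemma singleton_in_path_sets:
  assumes "simple_graph V E" "v \<in> V"
  shows "{v} \<in> path_sets V E"
proof -
  have "{e\<in>E. e \<subseteq> {v}} = {}" using assms by (auto simp: simple_graph_def subset_singleton_iff)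
  moreover have "nbrs_in E {v} v = {}" using no_loop[OF assms(1)] by (auto simp: nbrs_in_def)
  ultimately show ?thesis
    using assms no_loop[OF assms(1)] by (simp add: path_sets_def thin_sets_def)
qed

lemma nbrs_in_set:
  assumes "i < length p"
  shows "nbrs_in E (set p) (p ! i) = (\<lambda>j. p ! j) ` {j. j < length p \<and> {p ! i, p ! j} \<in> E}"
  by (auto simp: nbrs_in_def in_set_conv_nth)

text \<open>Serves paths and cycles alike: \<open>I\<close> holds the indices that have a successor
  \<open>s\<close>. For a cycle these are all indices, with successor modulo the length; for a path,
  all but the last.\<close>

lemma induced_edges_succ:
  assumes sg: "simple_graph V E" and I: "I \<subseteq> {..<length p}" "s ` I \<subseteq> {..<length p}"
    and adj: "\<And>i j. i < length p \<Longrightarrow> j < length p \<Longrightarrow>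
      {p ! i, p ! j} \<in> E \<longleftrightarrow> i \<in> I \<and> j = s i \<or> j \<in> I \<and> i = s j"
  shows "{e\<in>E. e \<subseteq> set p} = (\<lambda>i. {p ! i, p ! s i}) ` I"
proof (intro equalityI subsetI)
  fix e assume "e \<in> {e\<in>E. e \<subseteq> set p}"
  then have e: "e \<in> E" "e \<subseteq> set p" by auto
  have "card e = 2" using sg e by (auto simp: simple_graph_def)
  then obtain u v where uv: "e = {u, v}" by (auto simp: card_2_iff)
  then obtain i j where ij: "i < length p" "j < length p" "u = p ! i" "v = p ! j"
    using e by (metis in_set_conv_nth insert_subset)
  then have "i \<in> I \<and> j = s i \<or> j \<in> I \<and> i = s j" using adj e uv by blast
  then show "e \<in> (\<lambda>i. {p ! i, p ! s i}) ` I" using ij uv by (auto simp: insert_commute)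
next
  fix e assume "e \<in> (\<lambda>i. {p ! i, p ! s i}) ` I"
  then obtain i where i: "i \<in> I" "e = {p ! i, p ! s i}" by blast
  then have "i < length p" "s i < length p" using I by auto
  then show "e \<in> {e\<in>E. e \<subseteq> set p}" using i adj[of i "s i"] by auto
qed

lemma card_subset_doubleton: "S \<subseteq> {a, b} \<Longrightarrow> card S \<le> 2"
  by (rule order_trans[OF card_mono[of "{a, b}"]]) (auto simp: card_insert_if)

lemma eq_Suc_mod_iff:
  fixes i j n :: nat
  assumes "i < n" "j < n"
  shows "i = Suc j mod n \<longleftrightarrow> j = (if i = 0 then n - 1 else i - 1)"
  using assms by (auto simp: mod_Suc)

text \<open>The first three iterates of the cyclic successor have no fixed point; the third is the
  one that requires 4 and excludes triangles.\<close>

lemma Suc_mod_neq: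
  fixes i n :: nat
  assumes "4 \<le> n" "i < n"
  shows "Suc i mod n \<noteq> i \<and> Suc (Suc i mod n) mod n \<noteq> i \<and> Suc (Suc (Suc i mod n) mod n) mod n \<noteq> i"
  using assms by (simp add: mod_Suc)

text \<open>Each index is adjacent only to its cyclic successor and predecessor, so degrees are at
  most 2. Three pairwise adjacent indices would either be permuted cyclically by the successor or
  force a fixed point of it; length at least 4 rules out both.\<close>

lemma induced_cycle_thin:
  assumes c: "induced_cycle V E c" "length c \<ge> 4"
  shows "set c \<in> thin_sets V E"
proof -
  let ?n = "length c"
  define s where "s i = Suc i mod ?n" for i
  have adj: "{c ! i, c ! j} \<in> E \<longleftrightarrow> j = s i \<or> i = s j" if "i < ?n" "j < ?n" for i j
    using c(1) that unfolding induced_cycle_def s_def by blast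
  define r where "r i = (if i = 0 then ?n - 1 else i - 1)" for i
  have sr: "i = s j \<longleftrightarrow> j = r i" if "i < ?n" "j < ?n" for i j
    using eq_Suc_mod_iff[OF that] unfolding s_def r_def .
  have s_neq: "s i \<noteq> i \<and> s (s (s i)) \<noteq> i" if "i < ?n" for i
    using Suc_mod_neq[OF c(2) that] unfolding s_def by blast
  have deg: "card (nbrs_in E (set c) w) \<le> 2" if w: "w \<in> set c" for w
  proof -
    obtain i where i: "i < ?n" "w = c ! i" using w by (metis in_set_conv_nth)
    have "nbrs_in E (set c) w \<subseteq> {c ! s i, c ! r i}"
    proof
      fix v assume "v \<in> nbrs_in E (set c) w"
      then obtain j where j: "j < ?n" "v = c ! j" "{c ! i, c ! j} \<in> E"
        unfolding i(2) nbrs_in_set[OF i(1)] by blast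
      then have "j = s i \<or> j = r i" using adj[OF i(1) j(1)] sr[OF i(1) j(1)] by blast
      then show "v \<in> {c ! s i, c ! r i}" using j(2) by blast
    qed
    then show ?thesis by (rule card_subset_doubleton)
  qed
  have "\<not> ({c ! i, c ! j} \<in> E \<and> {c ! j, c ! k} \<in> E \<and> {c ! i, c ! k} \<in> E)"
    if "i < ?n" "j < ?n" "k < ?n" for i j k
    using that adj sr s_neq by metis
  then have "\<forall>x\<in>set c. \<forall>y\<in>set c. \<forall>z\<in>set c. \<not> ({x, y} \<in> E \<and> {y, z} \<in> E \<and> {x, z} \<in> E)"
    by (metis in_set_conv_nth)
  moreover have "set c \<subseteq> V" using c by (simp add: induced_cycle_def)
  ultimately show ?thesis
    using deg unfolding thin_sets_def by blast
qed

text \<open>Sending an index to the edge towards its successor is injective because the second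
  iterate of the successor has no fixed point. The equality makes the cycle vector parallel to the
  hyperplane.\<close>

lemma induced_cycle_card_edges:
  assumes sg: "simple_graph V E" and c: "induced_cycle V E c" "length c \<ge> 4"
  shows "card {e\<in>E. e \<subseteq> set c} = card (set c)"
proof -
  let ?n = "length c"
  define s where "s i = Suc i mod ?n" for i
  have adj: "{c ! i, c ! j} \<in> E \<longleftrightarrow> j = s i \<or> i = s j" if "i < ?n" "j < ?n" for i j
    using c(1) that unfolding induced_cycle_def s_def by blast
  have dist: "distinct c" using c by (simp add: induced_cycle_def)
  have s_less: "s i < ?n" for i
    using c(2) unfolding s_def by (intro mod_less_divisor) linarith
  have s_neq: "s (s i) \<noteq> i" if "i < ?n" for i
    using Suc_mod_neq[OF c(2) that] unfolding s_def by blast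
  have "{e\<in>E. e \<subseteq> set c} = (\<lambda>i. {c ! i, c ! s i}) ` {..<?n}"
    using adj s_less by (intro induced_edges_succ[OF sg]) auto
  moreover have "inj_on (\<lambda>i. {c ! i, c ! s i}) {..<?n}"
  proof (rule inj_onI)
    fix i j assume ij: "i \<in> {..<?n}" "j \<in> {..<?n}" and eq: "{c ! i, c ! s i} = {c ! j, c ! s j}"
    then have "i = j \<or> i = s j \<and> s i = j"
      using s_less dist by (auto simp: doubleton_eq_iff nth_eq_iff_index_eq)
    then show "i = j" using ij s_neq by auto
  qed
  ultimately show ?thesis
    using dist by (simp add: card_image distinct_card)
qed

lemma induced_path_in_path_sets:
  assumes sg: "simple_graph V E" and path: "induced_path V E p"
  shows "set p \<in> path_sets V E"
proof -
  have p: "p \<noteq> []" "distinct p" "set p \<subseteq> V" using path by (auto simp: induced_path_def)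
  have adj: "{p ! i, p ! j} \<in> E \<longleftrightarrow> j = Suc i \<or> i = Suc j" if "i < length p" "j < length p" for i j
    using path that by (simp add: induced_path_def)
  have deg: "card (nbrs_in E (set p) w) \<le> 2" if w: "w \<in> set p" for w
  proof -
    obtain i where i: "i < length p" "w = p ! i" using w by (metis in_set_conv_nth)
    \<comment> \<open>Only an upper bound is wanted, so the boundary is harmless: at the first index
      \<open>i - 1\<close> is again 0, at the last one \<open>Suc i\<close> lies beyond the
      list.\<close>
    have "nbrs_in E (set p) w \<subseteq> {p ! Suc i, p ! (i - 1)}"
      unfolding i(2) nbrs_in_set[OF i(1)] using i adj by auto
    then show ?thesis by (rule card_subset_doubleton)
  qed
  have "\<not> ({p ! i, p ! j} \<in> E \<and> {p ! j, p ! k} \<in> E \<and> {p ! i, p ! k} \<in> E)"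
    if "i < length p" "j < length p" "k < length p" for i j k
    using that by (auto simp: adj)
  then have "\<forall>x\<in>set p. \<forall>y\<in>set p. \<forall>z\<in>set p. \<not> ({x, y} \<in> E \<and> {y, z} \<in> E \<and> {x, z} \<in> E)"
    by (metis in_set_conv_nth)
  then have thin: "set p \<in> thin_sets V E"
    using deg p(3) unfolding thin_sets_def by blast
  have "{e\<in>E. e \<subseteq> set p} = (\<lambda>i. {p ! i, p ! Suc i}) ` {..<length p - 1}"
    by (intro induced_edges_succ[OF sg]) (auto simp: adj)
  moreover have "inj_on (\<lambda>i. {p ! i, p ! Suc i}) {..<length p - 1}"
    using p(2) by (auto simp: inj_on_def doubleton_eq_iff nth_eq_iff_index_eq)
  ultimately have "card {e\<in>E. e \<subseteq> set p} = length p - 1" by (simp add: card_image)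
  then show ?thesis using thin p by (simp add: path_sets_def distinct_card)
qed

section \<open>An induced cycle makes the polyhedron unbounded\<close>

lemma cone_P_convex_cone:
  fixes V :: "'a::finite set"
  shows "convex_cone (cone_P V E)"
  unfolding convex_cone_iff
proof (intro conjI ballI allI impI)
  show "0 \<in> cone_P V E" by (simp add: cone_P_def graph_space_def zero_prod_def)
next
  fix p q assume pq: "p \<in> cone_P V E" "q \<in> cone_P V E"
  obtain x y x' y' where xy: "p = (x, y)" "q = (x', y')" by fastforce
  have "(\<Sum>e\<in>A. y $ e + y' $ e) + 2 * (\<Sum>e\<in>B. y $ e + y' $ e) \<le> 2 * (x $ w + x' $ w)"
    if "(\<Sum>e\<in>A. y $ e) + 2 * (\<Sum>e\<in>B. y $ e) \<le> 2 * x $ w"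
      "(\<Sum>e\<in>A. y' $ e) + 2 * (\<Sum>e\<in>B. y' $ e) \<le> 2 * x' $ w" for A B w
    using that by (simp add: sum.distrib algebra_simps)
  then show "p + q \<in> cone_P V E"
    using pq unfolding xy cone_P_def graph_space_def by simp
next
  fix p c assume p: "p \<in> cone_P V E" and c: "(c::real) \<ge> 0"
  obtain x y where xy: "p = (x, y)" by fastforce
  have "(\<Sum>e\<in>A. c * y $ e) + 2 * (\<Sum>e\<in>B. c * y $ e) \<le> 2 * (c * x $ w)"
    if "(\<Sum>e\<in>A. y $ e) + 2 * (\<Sum>e\<in>B. y $ e) \<le> 2 * x $ w" for A B w
    using mult_left_mono[OF that c] by (simp add: sum_distrib_left[symmetric] algebra_simps)
  then show "c *\<^sub>R p \<in> cone_P V E"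
    using p c unfolding xy cone_P_def graph_space_def by simp
qed

text \<open>A single vertex gives a point of the polyhedron. Adding any nonnegative multiple of the
  cycle vector stays in the cone and does not change vertices minus edges.\<close>

lemma graph_polyhedron_unbounded:
  fixes V :: "'a::finite set"
  assumes sg: "simple_graph V E" and c: "induced_cycle V E c" "length c \<ge> 4"
  shows "\<not> bounded (graph_polyhedron V E)"
proof
  assume "bounded (graph_polyhedron V E)"
  then obtain B where B: "\<And>p. p \<in> graph_polyhedron V E \<Longrightarrow> norm p \<le> B"
    unfolding bounded_iff by blast
  let ?v = "c ! 0"
  have cV: "set c \<subseteq> V" using c by (simp add: induced_cycle_def)
  have "0 < length c" using c(2) by linarith
  then have v: "?v \<in> set c" "?v \<in> V" using cV nth_mem by blast+
  \<comment> \<open>The base vertex lies on the cycle, so its coordinate in \<open>p\<close> is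
    \<open>1 + k\<close>, which exceeds \<open>B\<close>.\<close>
  define k where "k = \<bar>B\<bar> + 1"
  define p where "p = induced_vec E {?v} + k *\<^sub>R induced_vec E (set c)"
  have ps: "{?v} \<in> path_sets V E" using singleton_in_path_sets[OF sg v(2)] .
  have "p \<in> cone_P V E"
    unfolding p_def using ps induced_cycle_thin[OF c]
    by (intro convex_cone_add[OF cone_P_convex_cone] convex_cone_scaleR[OF cone_P_convex_cone]
        induced_vec_in_cone_P[OF sg]) (auto simp: k_def path_sets_def)
  moreover have "(\<Sum>v\<in>V. fst p $ v) - (\<Sum>e\<in>E. snd p $ e) = 1"
  proof -
    have "(\<Sum>v\<in>V. fst p $ v) - (\<Sum>e\<in>E. snd p $ e)
      = ((\<Sum>v\<in>V. fst (induced_vec E {?v}) $ v) - (\<Sum>e\<in>E. snd (induced_vec E {?v}) $ e))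
      + k * ((\<Sum>v\<in>V. fst (induced_vec E (set c)) $ v) - (\<Sum>e\<in>E. snd (induced_vec E (set c)) $ e))"
      by (simp add: p_def sum.distrib sum_distrib_left[symmetric] algebra_simps)
    also have "\<dots> = 1"
      using ps induced_cycle_card_edges[OF sg c] induced_vec_sum[OF cV] induced_vec_sum[of "{?v}" V E] v
      by (simp add: path_sets_def)
    finally show ?thesis .
  qed
  ultimately have "p \<in> graph_polyhedron V E" by (auto simp: graph_polyhedron_def)
  then have "norm p \<le> B" by (rule B)
  moreover have "fst p $ ?v = 1 + k" using v by (simp add: p_def induced_vec_def)
  then have "1 + k \<le> norm (fst p)"
    using component_le_norm_cart[of "fst p" ?v] by simp
  then have "1 + k \<le> norm p" using norm_fst_le[of "fst p" "snd p"] by simp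
  ultimately show False by (simp add: k_def)
qed

section \<open>Transportation and fractional matchings\<close>

text \<open>A weighted Hall theorem: feasibility of a transportation problem with supplies
  \<open>a\<close>, capacities \<open>b\<close> and admissible pairs \<open>Q\<close>. The induction
  is on the number of positive supplies plus that of positive capacities.\<close>

lemma transportation:
  fixes a :: "'r \<Rightarrow> real" and b :: "'c \<Rightarrow> real"
  assumes "finite R" "finite C" "\<forall>r\<in>R. a r \<ge> 0" "\<forall>c\<in>C. b c \<ge> 0"
    and "\<forall>A\<subseteq>R. sum a A \<le> sum b {c\<in>C. \<exists>r\<in>A. Q r c}"
  obtains t where "\<forall>r c. t r c \<ge> 0" "\<forall>r c. t r c \<noteq> 0 \<longrightarrow> r \<in> R \<and> c \<in> C \<and> Q r c"
    "\<forall>r\<in>R. (\<Sum>c\<in>C. t r c) = a r" "\<forall>c\<in>C. (\<Sum>r\<in>R. t r c) \<le> b c"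
proof -
  have "\<exists>t. (\<forall>r c. t r c \<ge> 0) \<and> (\<forall>r c. t r c \<noteq> 0 \<longrightarrow> r \<in> R \<and> c \<in> C \<and> Q r c) \<and>
    (\<forall>r\<in>R. (\<Sum>c\<in>C. t r c) = a r) \<and> (\<forall>c\<in>C. (\<Sum>r\<in>R. t r c) \<le> b c)"
    using assms
  proof (induction "card {r\<in>R. a r > 0} + card {c\<in>C. b c > 0}" arbitrary: R C a b rule: less_induct)
    case (less R C a b)
    note finR = less.prems(1) and finC = less.prems(2) and a0 = less.prems(3) and b0 = less.prems(4)
      and hall = less.prems(5)
    show ?case
    proof (cases "\<forall>r\<in>R. a r = 0")
      case True
      then show ?thesis using b0 by (intro exI[of _ "\<lambda>_ _. 0"]) auto
    next
      case False
      define \<Gamma> where "\<Gamma> A = {c\<in>C. \<exists>r\<in>A. Q r c}" for A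
      have fin\<Gamma>: "finite (\<Gamma> A)" for A using finC by (simp add: \<Gamma>_def)
      \<comment> \<open>Ship as much as Hall's condition permits from \<open>r\<close> to \<open>c\<close>. Then a supply or a demand is
        used up, or Hall's condition is tight for some row set and the problem splits in two.\<close>
      from False a0 obtain r where r: "r \<in> R" "a r > 0" by (metis order_less_le)
      have "sum b (\<Gamma> {r}) > 0" using hall[rule_format, of "{r}"] r by (simp add: \<Gamma>_def)
      then obtain c where c: "c \<in> \<Gamma> {r}" "b c > 0"
        by (metis less_le_not_le linorder_le_less_linear sum_nonpos)
      then have cC: "c \<in> C" "Q r c" by (auto simp: \<Gamma>_def)
      \<comment> \<open>Shipping from \<open>r\<close> to \<open>c\<close> lowers both sides of
        Hall's inequality if \<open>A\<close> contains \<open>r\<close>, and neither if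
        \<open>c\<close> is not in \<open>\<Gamma> A\<close>. Only the sets in \<open>F\<close> lose
        slack, and \<open>g\<close> measures how much they have.\<close>
      define F where "F = {A. A \<subseteq> R \<and> r \<notin> A \<and> c \<in> \<Gamma> A}"
      define g where "g A = sum b (\<Gamma> A) - sum a A" for A
      define \<epsilon> where "\<epsilon> = Min (insert (a r) (insert (b c) (g ` F)))"
      have finF: "finite F" using finR by (simp add: F_def)
      have \<epsilon>_le: "\<epsilon> \<le> a r" "\<epsilon> \<le> b c" "\<And>A. A \<in> F \<Longrightarrow> \<epsilon> \<le> g A"
        unfolding \<epsilon>_def using finF by (simp_all del: Min_insert add: Min.coboundedI)
      have \<epsilon>_mem: "\<epsilon> \<in> insert (a r) (insert (b c) (g ` F))"
        unfolding \<epsilon>_def using finF by (intro Min_in) auto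
      have "g A \<ge> 0" if "A \<in> F" for A
        using hall that by (simp add: F_def g_def \<Gamma>_def)
      then have \<epsilon>0: "\<epsilon> \<ge> 0"
        using \<epsilon>_mem r(2) c(2) by auto
      define a' where "a' = a(r := a r - \<epsilon>)"
      define b' where "b' = b(c := b c - \<epsilon>)"
      have a'0: "\<forall>r\<in>R. a' r \<ge> 0" and b'0: "\<forall>c\<in>C. b' c \<ge> 0"
        using a0 b0 \<epsilon>_le by (auto simp: a'_def b'_def)
      have a'le: "a' x \<le> a x" and b'le: "b' y \<le> b y" for x y
        using \<epsilon>0 by (auto simp: a'_def b'_def)
      have suma: "sum a' A = sum a A - (if r \<in> A then \<epsilon> else 0)" if "finite A" for A
      proof -
        have "sum a' A = (\<Sum>x\<in>A. a x - (if x = r then \<epsilon> else 0))"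
          by (rule sum.cong) (auto simp: a'_def)
        then show ?thesis using that by (simp add: sum_subtractf sum.delta)
      qed
      have sumb: "sum b' A = sum b A - (if c \<in> A then \<epsilon> else 0)" if "finite A" for A
      proof -
        have "sum b' A = (\<Sum>x\<in>A. b x - (if x = c then \<epsilon> else 0))"
          by (rule sum.cong) (auto simp: b'_def)
        then show ?thesis using that by (simp add: sum_subtractf sum.delta)
      qed
      have hall': "sum a' A \<le> sum b' (\<Gamma> A)" if A: "A \<subseteq> R" for A
      proof -
        have fA: "finite A" using A finR finite_subset by blast
        have h: "sum a A \<le> sum b (\<Gamma> A)" using hall A by (simp add: \<Gamma>_def)
        have "r \<in> A \<Longrightarrow> c \<in> \<Gamma> A" using cC by (auto simp: \<Gamma>_def)
        moreover have "r \<notin> A \<Longrightarrow> c \<in> \<Gamma> A \<Longrightarrow> \<epsilon> \<le> sum b (\<Gamma> A) - sum a A"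
          using \<epsilon>_le(3)[of A] A by (simp add: F_def g_def)
        ultimately show ?thesis using h \<epsilon>0 by (auto simp: suma[OF fA] sumb[OF fin\<Gamma>])
      qed
      have mono: "card {x\<in>R'. a' x > 0} \<le> card {x\<in>R. a x > 0}"
        "card {y\<in>C'. b' y > 0} \<le> card {y\<in>C. b y > 0}"
        if "R' \<subseteq> R" "C' \<subseteq> C" for R' C'
        using that finR finC less_le_trans[OF _ a'le] less_le_trans[OF _ b'le]
        by (auto intro!: card_mono)
      have monor: "card {x\<in>R'. a' x > 0} < card {x\<in>R. a x > 0}"
        if "R' \<subseteq> R" "\<not> (r \<in> R' \<and> a' r > 0)" for R'
        using that finR r less_le_trans[OF _ a'le]
        by (auto intro!: psubset_card_mono)
      have monoc: "card {y\<in>C'. b' y > 0} < card {y\<in>C. b y > 0}"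
        if "C' \<subseteq> C" "\<not> (c \<in> C' \<and> b' c > 0)" for C'
        using that finC c cC less_le_trans[OF _ b'le]
        by (auto intro!: psubset_card_mono)
      have "\<exists>t. (\<forall>r c. t r c \<ge> 0) \<and> (\<forall>r c. t r c \<noteq> 0 \<longrightarrow> r \<in> R \<and> c \<in> C \<and> Q r c) \<and>
        (\<forall>r\<in>R. (\<Sum>c\<in>C. t r c) = a' r) \<and> (\<forall>c\<in>C. (\<Sum>r\<in>R. t r c) \<le> b' c)"
      proof (cases "\<epsilon> = a r \<or> \<epsilon> = b c")
        case True
        then have "\<not> a' r > 0 \<or> \<not> b' c > 0" by (auto simp: a'_def b'_def)
        then have "card {x\<in>R. a' x > 0} + card {y\<in>C. b' y > 0} < card {x\<in>R. a x > 0} + card {y\<in>C. b y > 0}"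
          using mono[of R C] monor[of R] monoc[of C] by fastforce
        from less.hyps[OF this finR finC a'0 b'0] hall' show ?thesis by (auto simp: \<Gamma>_def)
      next
        case False
        \<comment> \<open>After the shipment \<open>A0\<close> is tight, so its rows fill
          \<open>\<Gamma> A0\<close> completely and the other rows are left with the remaining
          columns. The first subproblem lacks \<open>r\<close>, the second lacks \<open>c\<close>,
          so both are smaller. Hall's condition for the second follows from that for
          \<open>A0 \<union> A\<close> by cancelling the tight part.\<close>
        then obtain A0 where A0: "A0 \<in> F" and \<epsilon>A: "\<epsilon> = g A0" using \<epsilon>_mem by auto
        then have A0R: "A0 \<subseteq> R" "r \<notin> A0" "c \<in> \<Gamma> A0" by (auto simp: F_def)
        have fA0: "finite A0" using A0R finR finite_subset by blast
        have tight: "sum a' A0 = sum b' (\<Gamma> A0)"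
          using \<epsilon>A A0R by (simp add: suma[OF fA0] sumb[OF fin\<Gamma>] g_def)
        have \<Gamma>C: "\<Gamma> A0 \<subseteq> C" by (auto simp: \<Gamma>_def)
        have "\<exists>t. (\<forall>r c. t r c \<ge> 0) \<and> (\<forall>r c. t r c \<noteq> 0 \<longrightarrow> r \<in> A0 \<and> c \<in> \<Gamma> A0 \<and> Q r c) \<and>
          (\<forall>r\<in>A0. (\<Sum>c\<in>\<Gamma> A0. t r c) = a' r) \<and> (\<forall>c\<in>\<Gamma> A0. (\<Sum>r\<in>A0. t r c) \<le> b' c)"
        proof (rule less.hyps)
          show "card {x\<in>A0. a' x > 0} + card {y\<in>\<Gamma> A0. b' y > 0} < card {x\<in>R. a x > 0} + card {y\<in>C. b y > 0}"
            using monor[of A0] mono(2)[of A0 "\<Gamma> A0"] A0R \<Gamma>C by fastforce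
          show "\<forall>A\<subseteq>A0. sum a' A \<le> sum b' {c\<in>\<Gamma> A0. \<exists>r\<in>A. Q r c}"
          proof (intro allI impI)
            fix A assume "A \<subseteq> A0"
            moreover from this have "{c\<in>\<Gamma> A0. \<exists>r\<in>A. Q r c} = \<Gamma> A" by (auto simp: \<Gamma>_def)
            ultimately show "sum a' A \<le> sum b' {c\<in>\<Gamma> A0. \<exists>r\<in>A. Q r c}" using hall' A0R by auto
          qed
        qed (use fA0 fin\<Gamma> a'0 b'0 A0R \<Gamma>C in auto)
        then obtain t1 where t1: "\<forall>r c. t1 r c \<ge> 0" "\<forall>r c. t1 r c \<noteq> 0 \<longrightarrow> r \<in> A0 \<and> c \<in> \<Gamma> A0 \<and> Q r c"
          "\<forall>r\<in>A0. (\<Sum>c\<in>\<Gamma> A0. t1 r c) = a' r" "\<forall>c\<in>\<Gamma> A0. (\<Sum>r\<in>A0. t1 r c) \<le> b' c" by blast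
        have "\<exists>t. (\<forall>r c. t r c \<ge> 0) \<and> (\<forall>r c. t r c \<noteq> 0 \<longrightarrow> r \<in> R - A0 \<and> c \<in> C - \<Gamma> A0 \<and> Q r c) \<and>
          (\<forall>r\<in>R - A0. (\<Sum>c\<in>C - \<Gamma> A0. t r c) = a' r) \<and> (\<forall>c\<in>C - \<Gamma> A0. (\<Sum>r\<in>R - A0. t r c) \<le> b' c)"
        proof (rule less.hyps)
          show "card {x\<in>R - A0. a' x > 0} + card {y\<in>C - \<Gamma> A0. b' y > 0} < card {x\<in>R. a x > 0} + card {y\<in>C. b y > 0}"
            using monoc[of "C - \<Gamma> A0"] mono(1)[of "R - A0" "C"] A0R by fastforce
          show "\<forall>A\<subseteq>R - A0. sum a' A \<le> sum b' {c\<in>C - \<Gamma> A0. \<exists>r\<in>A. Q r c}"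
          proof (intro allI impI)
            fix A assume A: "A \<subseteq> R - A0"
            have fA: "finite A" using A finR finite_subset by blast
            have "sum a' A0 + sum a' A = sum a' (A0 \<union> A)"
              using A fA fA0 by (intro sum.union_disjoint[symmetric]) auto
            also have "\<dots> \<le> sum b' (\<Gamma> (A0 \<union> A))" using hall'[of "A0 \<union> A"] A A0R by auto
            also have "\<Gamma> (A0 \<union> A) = \<Gamma> A0 \<union> {c\<in>C - \<Gamma> A0. \<exists>r\<in>A. Q r c}" by (auto simp: \<Gamma>_def)
            also have "sum b' \<dots> = sum b' (\<Gamma> A0) + sum b' {c\<in>C - \<Gamma> A0. \<exists>r\<in>A. Q r c}"
              using fin\<Gamma> finC by (intro sum.union_disjoint) auto
            finally show "sum a' A \<le> sum b' {c\<in>C - \<Gamma> A0. \<exists>r\<in>A. Q r c}" using tight by simp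
          qed
        qed (use finR finC a'0 b'0 in auto)
        then obtain t2 where t2: "\<forall>r c. t2 r c \<ge> 0"
          "\<forall>r c. t2 r c \<noteq> 0 \<longrightarrow> r \<in> R - A0 \<and> c \<in> C - \<Gamma> A0 \<and> Q r c"
          "\<forall>r\<in>R - A0. (\<Sum>c\<in>C - \<Gamma> A0. t2 r c) = a' r"
          "\<forall>c\<in>C - \<Gamma> A0. (\<Sum>r\<in>R - A0. t2 r c) \<le> b' c" by blast
        show ?thesis
        proof (intro exI[of _ "\<lambda>x y. t1 x y + t2 x y"] conjI allI impI ballI)
          fix x y assume "t1 x y + t2 x y \<noteq> 0"
          then have "t1 x y \<noteq> 0 \<or> t2 x y \<noteq> 0" by auto
          then show "x \<in> R" "y \<in> C" "Q x y" using t1(2) t2(2) A0R(1) \<Gamma>C by blast+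
        next
          fix x assume x: "x \<in> R"
          have "(\<Sum>y\<in>C. t1 x y) = (\<Sum>y\<in>\<Gamma> A0. t1 x y)"
            using t1(2) finC \<Gamma>C by (intro sum.mono_neutral_right) auto
          moreover have "(\<Sum>y\<in>C. t2 x y) = (\<Sum>y\<in>C - \<Gamma> A0. t2 x y)"
            using t2(2) finC \<Gamma>C by (intro sum.mono_neutral_right) auto
          moreover have "x \<notin> A0 \<Longrightarrow> t1 x y = 0" "x \<in> A0 \<Longrightarrow> t2 x y = 0" for y
            using t1(2) t2(2) by auto
          ultimately show "(\<Sum>y\<in>C. t1 x y + t2 x y) = a' x"
            using t1(3) t2(3) x by (cases "x \<in> A0") (auto simp: sum.distrib)
        next
          fix y assume y: "y \<in> C"
          have "(\<Sum>x\<in>R. t1 x y) = (\<Sum>x\<in>A0. t1 x y)"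
            using t1(2) finR A0R by (intro sum.mono_neutral_right) auto
          moreover have "(\<Sum>x\<in>R. t2 x y) = (\<Sum>x\<in>R - A0. t2 x y)"
            using t2(2) finR by (intro sum.mono_neutral_right) auto
          moreover have "y \<notin> \<Gamma> A0 \<Longrightarrow> t1 x y = 0" "y \<in> \<Gamma> A0 \<Longrightarrow> t2 x y = 0" for x
            using t1(2) t2(2) by auto
          ultimately show "(\<Sum>x\<in>R. t1 x y + t2 x y) \<le> b' y"
            using t1(4) t2(4) y by (cases "y \<in> \<Gamma> A0") (auto simp: sum.distrib)
        qed (use t1(1) t2(1) in auto)
      qed
      then obtain t where t: "\<forall>r c. t r c \<ge> 0" "\<forall>r c. t r c \<noteq> 0 \<longrightarrow> r \<in> R \<and> c \<in> C \<and> Q r c"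
        "\<forall>r\<in>R. (\<Sum>c\<in>C. t r c) = a' r" "\<forall>c\<in>C. (\<Sum>r\<in>R. t r c) \<le> b' c" by blast
      define s where "s x y = (if x = r then if y = c then \<epsilon> else 0 else 0)" for x y
      have s: "(\<Sum>y\<in>C. s x y) = (if x = r then \<epsilon> else 0)" "(\<Sum>x\<in>R. s x y) = (if y = c then \<epsilon> else 0)" for x y
        using finR finC r cC by (auto simp: s_def)
      show ?thesis
      proof (intro exI[of _ "\<lambda>x y. t x y + s x y"] conjI allI impI ballI)
        fix x y assume "t x y + s x y \<noteq> 0"
        then show "x \<in> R" "y \<in> C" "Q x y"
          using t(2) r cC by (auto simp: s_def split: if_splits)
      next
        fix x assume "x \<in> R" then show "(\<Sum>y\<in>C. t x y + s x y) = a x"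
          using t(3) s by (auto simp: sum.distrib a'_def)
      next
        fix y assume "y \<in> C" then show "(\<Sum>x\<in>R. t x y + s x y) \<le> b y"
          using t(4) s by (force simp: sum.distrib b'_def)
      qed (use t(1) \<epsilon>0 in \<open>auto simp: s_def\<close>)
    qed
  qed
  then show thesis using that by blast
qed

text \<open>Duality for fractional matchings in the graph \<open>Q\<close> with vertex capacities
  \<open>y\<close>; the sets \<open>K\<close> become cliques when \<open>Q\<close> is nonadjacency.
  The proof passes to the bipartite double cover and applies \<open>transportation\<close>. The
  double sum counts each matched pair twice, hence the division by 2.\<close>

lemma fractional_matching:
  fixes y :: "'v \<Rightarrow> real" and X :: real
  assumes fin: "finite N" and y0: "\<forall>u\<in>N. y u \<ge> 0"
    and sym: "\<And>u v. Q u v \<Longrightarrow> Q v u"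
    and cover: "\<And>K. K \<subseteq> N \<Longrightarrow> \<forall>u\<in>K. \<forall>v\<in>K. \<not> Q u v \<Longrightarrow>
      sum y {v \<in> N - K. \<forall>u\<in>K. \<not> Q u v} + 2 * sum y K \<le> 2 * X"
  obtains t where "\<And>u v. t u v \<ge> 0" "\<And>u v. t u v = t v u"
    "\<And>u v. t u v \<noteq> 0 \<Longrightarrow> u \<in> N \<and> v \<in> N \<and> Q u v"
    "\<And>u. u \<in> N \<Longrightarrow> (\<Sum>v\<in>N. t u v) \<le> y u"
    "sum y N - (\<Sum>u\<in>N. \<Sum>v\<in>N. t u v) / 2 \<le> X"
proof -
  \<comment> \<open>The conclusion says that the weight left unmatched is at most \<open>D\<close>.
    The cover condition for the empty set makes \<open>D\<close> nonnegative.\<close>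
  define D where "D = 2 * X - sum y N"
  define b where "b = case_option D y"
  define Q' where "Q' u = case_option True (Q u)" for u
  have D0: "D \<ge> 0" using cover[of "{}"] by (simp add: D_def)
  \<comment> \<open>The column \<open>None\<close> absorbs the weight that stays unmatched.\<close>
  obtain s where s: "\<forall>r c. s r c \<ge> 0"
    "\<forall>r c. s r c \<noteq> 0 \<longrightarrow> r \<in> N \<and> c \<in> insert None (Some ` N) \<and> Q' r c"
    "\<forall>r\<in>N. (\<Sum>c\<in>insert None (Some ` N). s r c) = y r"
    "\<forall>c\<in>insert None (Some ` N). (\<Sum>r\<in>N. s r c) \<le> b c"
  proof (rule transportation[of N "insert None (Some ` N)" y b Q'])
    show "\<forall>A\<subseteq>N. sum y A \<le> sum b {c \<in> insert None (Some ` N). \<exists>r\<in>A. Q' r c}"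
    proof (intro allI impI)
      fix A assume A: "A \<subseteq> N"
      have fA: "finite A" using A fin finite_subset by blast
      define \<Gamma> where "\<Gamma> B = {v\<in>N. \<exists>u\<in>B. Q u v}" for B
      \<comment> \<open>\<open>K\<close> collects the members of \<open>A\<close> without a
        \<open>Q\<close>-neighbour in \<open>A\<close>, so it contains no \<open>Q\<close>-pair. By
        symmetry \<open>\<Gamma> K\<close> is disjoint from \<open>A\<close>; hence
        \<open>\<Gamma> K\<close> and \<open>A \<inter> \<Gamma> A\<close> are disjoint parts of
        \<open>\<Gamma> A\<close>, and the cover condition for \<open>K\<close> yields Hall's
        condition for \<open>A\<close>.\<close>
      define K where "K = A - \<Gamma> A"
      define C where "C = {v \<in> N - K. \<forall>u\<in>K. \<not> Q u v}"
      have fins: "finite K" "finite C" "finite (\<Gamma> B)" for B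
        using fin fA by (auto simp: K_def C_def \<Gamma>_def)
      have "sum y C + 2 * sum y K \<le> 2 * X"
        unfolding C_def using A by (intro cover) (auto simp: K_def \<Gamma>_def)
      moreover have "sum y N = sum y K + sum y C + sum y (\<Gamma> K)"
      proof -
        have "N = K \<union> C \<union> \<Gamma> K" using A by (auto simp: C_def K_def \<Gamma>_def)
        moreover have "\<Gamma> K \<subseteq> \<Gamma> A" by (auto simp: K_def \<Gamma>_def)
        then have "K \<inter> \<Gamma> K = {}" unfolding K_def by blast
        moreover have "K \<inter> C = {}" "C \<inter> \<Gamma> K = {}" by (auto simp: C_def \<Gamma>_def)
        ultimately have "N = K \<union> C \<union> \<Gamma> K" "K \<inter> C = {}" "(K \<union> C) \<inter> \<Gamma> K = {}" by blast+
        then show ?thesis using fins by (simp add: sum.union_disjoint)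
      qed
      moreover have "sum y A = sum y K + sum y (A \<inter> \<Gamma> A)"
        using fA unfolding K_def by (metis sum.Int_Diff add.commute)
      moreover have "sum y (A \<inter> \<Gamma> A) + sum y (\<Gamma> K) \<le> sum y (\<Gamma> A)"
      proof -
        have "A \<inter> \<Gamma> K = {}" unfolding K_def \<Gamma>_def using A sym by blast
        then have "sum y (A \<inter> \<Gamma> A) + sum y (\<Gamma> K) = sum y (A \<inter> \<Gamma> A \<union> \<Gamma> K)"
          using fins fA by (intro sum.union_disjoint[symmetric]) auto
        also have "\<dots> \<le> sum y (\<Gamma> A)"
          using fins y0 by (intro sum_mono2) (auto simp: K_def \<Gamma>_def)
        finally show ?thesis .
      qed
      ultimately have le: "sum y A \<le> D + sum y (\<Gamma> A)" by (simp add: D_def)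
      show "sum y A \<le> sum b {c \<in> insert None (Some ` N). \<exists>r\<in>A. Q' r c}"
      proof (cases "A = {}")
        case False
        have "{c \<in> insert None (Some ` N). \<exists>r\<in>A. Q' r c} = insert None (Some ` \<Gamma> A)"
          (is "?L = ?R")
        proof (rule set_eqI)
          show "c \<in> ?L \<longleftrightarrow> c \<in> ?R" for c
            using False by (cases c) (auto simp: Q'_def \<Gamma>_def)
        qed
        moreover have "sum b (insert None (Some ` \<Gamma> A)) = D + sum y (\<Gamma> A)"
          using fins by (simp add: b_def sum.reindex)
        ultimately show ?thesis using le by simp
      qed simp
    qed
  qed (use fin y0 D0 in \<open>auto simp: b_def\<close>)
  \<comment> \<open>Averaging \<open>s\<close> with its transpose turns the transport plan into a matching.\<close>
  define t where "t u v = (s u (Some v) + s v (Some u)) / 2" for u v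
  have row: "s u None + (\<Sum>v\<in>N. s u (Some v)) = y u" if "u \<in> N" for u
    using s(3) that fin by (simp add: sum.reindex)
  have col: "(\<Sum>v\<in>N. s v (Some u)) \<le> y u" if "u \<in> N" for u
    using s(4) that by (auto simp: b_def)
  have dummy: "(\<Sum>u\<in>N. s u None) \<le> D" using s(4) by (auto simp: b_def)
  have s0: "s u c \<ge> 0" for u c using s(1) by blast
  have supp: "u \<in> N \<and> v \<in> N \<and> Q u v" if "s u (Some v) \<noteq> 0" for u v
    using s(2) that by (force simp: Q'_def)
  show thesis
  proof
    show "t u v \<ge> 0" "t u v = t v u" for u v using s0 by (auto simp: t_def)
    show "u \<in> N \<and> v \<in> N \<and> Q u v" if "t u v \<noteq> 0" for u v
      using supp[of u v] supp[of v u] that sym by (cases "s u (Some v) = 0") (auto simp: t_def)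
    have tsum: "(\<Sum>v\<in>N. t u v) = ((\<Sum>v\<in>N. s u (Some v)) + (\<Sum>v\<in>N. s v (Some u))) / 2" for u
      by (simp add: t_def sum.distrib flip: sum_divide_distrib)
    show "(\<Sum>v\<in>N. t u v) \<le> y u" if "u \<in> N" for u
      using row[OF that] col[OF that] s0[of u None] by (simp add: tsum)
    have "(\<Sum>u\<in>N. \<Sum>v\<in>N. t u v) = (\<Sum>u\<in>N. \<Sum>v\<in>N. s u (Some v))"
      by (simp add: tsum sum.distrib sum.swap[of "\<lambda>u v. s v (Some u)"] flip: sum_divide_distrib)
    also have "\<dots> = (\<Sum>u\<in>N. y u - s u None)"
      using row by (intro sum.cong) (auto simp: algebra_simps)
    also have "\<dots> \<ge> sum y N - D" using dummy by (simp add: sum_subtractf)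
    finally show "sum y N - (\<Sum>u\<in>N. \<Sum>v\<in>N. t u v) / 2 \<le> X" by (simp add: D_def)
  qed
qed

section \<open>Decomposition into induced paths\<close>

text \<open>Strong induction on \<open>j - i\<close>: closer pairs that are at least 2 apart are
  distinct and nonadjacent. An edge between \<open>p ! i\<close> and \<open>p ! j\<close> would then
  close the segment between them to an induced cycle on \<open>j - i + 1\<close> vertices, at least
  4 unless \<open>j = i + 2\<close>.\<close>

lemma chordal_locally_induced_walk:
  assumes sg: "simple_graph V E" and ch: "chordal V E"
    and step: "\<And>i. Suc i < length p \<Longrightarrow> {p ! i, p ! Suc i} \<in> E"
    and local: "\<And>i. Suc (Suc i) < length p \<Longrightarrow> p ! i \<noteq> p ! Suc (Suc i) \<and> {p ! i, p ! Suc (Suc i)} \<notin> E"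
  shows "i + 2 \<le> j \<Longrightarrow> j < length p \<Longrightarrow> p ! i \<noteq> p ! j \<and> {p ! i, p ! j} \<notin> E"
proof (induction "j - i" arbitrary: i j rule: less_induct)
  case less
  show ?case
  proof (cases "j = i + 2")
    case True
    then show ?thesis using local[of i] less.prems by simp
  next
    case False
    \<comment> \<open>Equality would make \<open>p ! (j - 1)\<close> adjacent to
      \<open>p ! i\<close>, against the induction hypothesis for \<open>i\<close> and
      \<open>j - 1\<close>, which are still at least 2 apart.\<close>
    have neq: "p ! i \<noteq> p ! j"
      using less.hyps[of "j - 1" i] step[of "j - 1"] less.prems False
      by (cases j) (auto simp: insert_commute Suc_diff_le)
    have "{p ! i, p ! j} \<notin> E"
    proof
      assume ij: "{p ! i, p ! j} \<in> E"
      define c where "c = map (\<lambda>k. p ! (i + k)) [0..<Suc (j - i)]"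
      have len: "length c = Suc (j - i)" by (simp add: c_def)
      have nth: "c ! k = p ! (i + k)" if "k < length c" for k
        using that by (simp add: c_def del: upt_Suc)
      have far: "c ! k \<noteq> c ! l \<and> ({c ! k, c ! l} \<in> E \<longleftrightarrow> l = Suc k \<or> k = 0 \<and> l = j - i)"
        if "k < l" "l < length c" for k l
      proof -
        consider "l = Suc k" | "l \<noteq> Suc k" "k = 0" "l = j - i" | "l \<noteq> Suc k" "\<not> (k = 0 \<and> l = j - i)" by blast
        then show ?thesis
        proof cases
          case 1
          then show ?thesis
            using step[of "i + k"] that nth less.prems len edge_endpoints[OF sg] by auto
        next
          case 2
          then show ?thesis using ij neq nth that len less.prems by simp
        next
          case 3
          then have "i + l - (i + k) < j - i" "i + k + 2 \<le> i + l" "i + l < length p"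
            using that less.prems len by auto
          then have "p ! (i + k) \<noteq> p ! (i + l) \<and> {p ! (i + k), p ! (i + l)} \<notin> E"
            by (rule less.hyps)
          then show ?thesis using 3 nth that by simp
        qed
      qed
      have adj: "{c ! k, c ! l} \<in> E \<longleftrightarrow> l = Suc k mod length c \<or> k = Suc l mod length c"
        if kl: "k < length c" "l < length c" for k l
      proof (cases k l rule: linorder_cases)
        case less
        then show ?thesis using far[of k l] kl len \<open>i + 2 \<le> j\<close> by (auto simp: mod_Suc)
      next
        case equal
        then show ?thesis using no_loop[OF sg] kl len \<open>i + 2 \<le> j\<close> by (auto simp: mod_Suc)
      next
        case greater
        then show ?thesis using far[of l k] kl len \<open>i + 2 \<le> j\<close> by (auto simp: mod_Suc insert_commute)
      qed
      have "distinct c"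
        unfolding distinct_conv_nth using far by (metis linorder_neqE_nat)
      moreover have "set c \<subseteq> V"
      proof
        fix v assume "v \<in> set c"
        then obtain k where k: "k < length c" "v = p ! (i + k)" by (auto simp: in_set_conv_nth nth)
        show "v \<in> V"
        proof (cases "i + k < j")
          case True
          then show ?thesis using step[of "i + k"] edge_endpoints[OF sg] k less.prems by fastforce
        next
          case False
          then have "Suc (j - 1) = i + k" using k len less.prems by simp
          then show ?thesis using step[of "j - 1"] edge_endpoints[OF sg] k len less.prems by fastforce
        qed
      qed
      moreover have "length c \<ge> 4" using len less.prems False by simp
      ultimately have "induced_cycle V E c" unfolding induced_cycle_def using adj by simp
      then show False using ch \<open>length c \<ge> 4\<close> by (auto simp: chordal_def)
    qed
    with neq show ?thesis by blast
  qed
qed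

section \<open>Transition systems and their reduction along a path\<close>

definition slack :: "real ^ ('a::finite set) \<Rightarrow> ('a \<Rightarrow> 'a \<Rightarrow> 'a \<Rightarrow> real) \<Rightarrow> 'a \<Rightarrow> 'a \<Rightarrow> real" where
  "slack y t w u = y $ {w, u} - (\<Sum>v\<in>UNIV. t w u v)"

text \<open>\<open>t w u v\<close> is the total weight of the paths that traverse \<open>u\<close>, \<open>w\<close>, \<open>v\<close> consecutively, and
  \<open>slack y t w u\<close> that of the paths whose last edge leads from \<open>u\<close> to their end \<open>w\<close>. The last condition
  counts the paths through \<open>w\<close>, up to a factor of 2.\<close>

definition transition_system ::
    "'a::finite set \<Rightarrow> 'a set set \<Rightarrow> real ^ 'a \<Rightarrow> real ^ ('a set) \<Rightarrow> ('a \<Rightarrow> 'a \<Rightarrow> 'a \<Rightarrow> real) \<Rightarrow> bool" where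
  "transition_system V E x y t \<longleftrightarrow> (x, y) \<in> graph_space V E \<and>
     (\<forall>w u v. t w u v \<ge> 0 \<and> t w u v = t w v u \<and>
        (t w u v \<noteq> 0 \<longrightarrow> {w, u} \<in> E \<and> {w, v} \<in> E \<and> u \<noteq> v \<and> {u, v} \<notin> E)) \<and>
     (\<forall>w u. {w, u} \<in> E \<longrightarrow> slack y t w u \<ge> 0) \<and>
     (\<forall>w\<in>V. (\<Sum>u\<in>nbrs_in E V w. y $ {w, u} + slack y t w u) \<le> 2 * x $ w)"

text \<open>\<open>fractional_matching\<close> is applied separately at each vertex \<open>w\<close>
  to its neighbours, with nonadjacency as \<open>Q\<close>; its cover condition is then the cone
  inequality for the clique \<open>K\<close>. The last condition of the transition system arises
  because twice an edge weight minus its matched part is the weight plus the slack.\<close>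

lemma cone_P_transition_system:
  fixes V :: "'a::finite set"
  assumes sg: "simple_graph V E" and xy: "(x, y) \<in> cone_P V E"
  obtains t where "transition_system V E x y t"
proof -
  have y0: "y $ e \<ge> 0" if "e \<in> E" for e using xy that by (auto simp: cone_P_def)
  have ex: "\<forall>w. \<exists>t. (\<forall>u v. t u v \<ge> 0 \<and> t u v = t v u \<and>
        (t u v \<noteq> 0 \<longrightarrow> {w, u} \<in> E \<and> {w, v} \<in> E \<and> u \<noteq> v \<and> {u, v} \<notin> E)) \<and>
      (\<forall>u. {w, u} \<in> E \<longrightarrow> (\<Sum>v\<in>UNIV. t u v) \<le> y $ {w, u}) \<and>
      (w \<in> V \<longrightarrow> (\<Sum>u\<in>nbrs_in E V w. 2 * y $ {w, u} - (\<Sum>v\<in>UNIV. t u v)) \<le> 2 * x $ w)"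
    (is "\<forall>w. \<exists>t. ?Q w t")
  proof
    fix w show "\<exists>t. ?Q w t"
    proof (cases "w \<in> V")
      case False
      then have "{w, u} \<notin> E" for u using edge_endpoints[OF sg] by blast
      then show ?thesis using False by (intro exI[of _ "\<lambda>_ _. 0"]) auto
    next
      case True
      define N where "N = nbrs_in E V w"
      have N: "u \<in> N \<longleftrightarrow> {w, u} \<in> E" for u
        using edge_endpoints[OF sg] by (auto simp: N_def nbrs_in_def)
      obtain t where t: "\<And>u v. t u v \<ge> 0" "\<And>u v. t u v = t v u"
        "\<And>u v. t u v \<noteq> 0 \<Longrightarrow> u \<in> N \<and> v \<in> N \<and> (u \<noteq> v \<and> {u, v} \<notin> E)"
        "\<And>u. u \<in> N \<Longrightarrow> (\<Sum>v\<in>N. t u v) \<le> y $ {w, u}"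
        "(\<Sum>u\<in>N. y $ {w, u}) - (\<Sum>u\<in>N. \<Sum>v\<in>N. t u v) / 2 \<le> x $ w"
      proof (rule fractional_matching[of N "\<lambda>u. y $ {w, u}" "\<lambda>u v. u \<noteq> v \<and> {u, v} \<notin> E" "x $ w"])
        show "finite N" by simp
        show "\<forall>u\<in>N. 0 \<le> y $ {w, u}" using y0 N by blast
        show "v \<noteq> u \<and> {v, u} \<notin> E" if "u \<noteq> v \<and> {u, v} \<notin> E" for u v
          using that by (auto simp: insert_commute)
      next
        fix K assume K: "K \<subseteq> N" "\<forall>u\<in>K. \<forall>v\<in>K. \<not> (u \<noteq> v \<and> {u, v} \<notin> E)"
        have cl: "clique V E K" "K \<subseteq> neighbors V E w"
          using K by (auto simp: clique_def neighbors_def N_def nbrs_in_def)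
        have "(\<Sum>u\<in>nbrs_in E (common_neighbors V E (K \<union> {w})) w. y $ {w, u})
            + 2 * (\<Sum>u\<in>nbrs_in E K w. y $ {w, u}) \<le> 2 * x $ w"
          using xy cl True unfolding cone_P_def sum_edges_to by blast
        moreover have "nbrs_in E K w = K" using K(1) N by (auto simp: nbrs_in_def)
        moreover have "nbrs_in E (common_neighbors V E (K \<union> {w})) w =
            {v \<in> N - K. \<forall>u\<in>K. \<not> (u \<noteq> v \<and> {u, v} \<notin> E)}"
          using no_loop[OF sg] by (auto simp: nbrs_in_def common_neighbors_def N_def)
        ultimately show "(\<Sum>v\<in>{v \<in> N - K. \<forall>u\<in>K. \<not> (u \<noteq> v \<and> {u, v} \<notin> E)}. y $ {w, v})
            + 2 * (\<Sum>u\<in>K. y $ {w, u}) \<le> 2 * x $ w"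
          by (simp only:)
      qed (rule that)
      have UN: "(\<Sum>v\<in>UNIV. t u v) = (\<Sum>v\<in>N. t u v)" for u
        using t(3) by (intro sum.mono_neutral_right) auto
      have "(\<Sum>u\<in>N. 2 * y $ {w, u} - (\<Sum>v\<in>N. t u v)) \<le> 2 * x $ w"
        using t(5) by (simp add: sum_subtractf flip: sum_distrib_left)
      moreover have "\<forall>u v. t u v \<ge> 0 \<and> t u v = t v u \<and>
          (t u v \<noteq> 0 \<longrightarrow> {w, u} \<in> E \<and> {w, v} \<in> E \<and> u \<noteq> v \<and> {u, v} \<notin> E)"
        using t(1) t(2) t(3)[unfolded N] by (intro allI conjI impI) blast+
      moreover have "\<forall>u. {w, u} \<in> E \<longrightarrow> (\<Sum>v\<in>N. t u v) \<le> y $ {w, u}"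
        using t(4) N by blast
      ultimately show ?thesis
        unfolding N_def[symmetric] UN[symmetric] by (intro exI[of _ t] conjI impI)
    qed
  qed
  obtain t where t: "\<And>w. (\<forall>u v. t w u v \<ge> 0 \<and> t w u v = t w v u \<and>
        (t w u v \<noteq> 0 \<longrightarrow> {w, u} \<in> E \<and> {w, v} \<in> E \<and> u \<noteq> v \<and> {u, v} \<notin> E)) \<and>
      (\<forall>u. {w, u} \<in> E \<longrightarrow> (\<Sum>v\<in>UNIV. t w u v) \<le> y $ {w, u}) \<and>
      (w \<in> V \<longrightarrow> (\<Sum>u\<in>nbrs_in E V w. 2 * y $ {w, u} - (\<Sum>v\<in>UNIV. t w u v)) \<le> 2 * x $ w)"
    using choice[OF ex] by blast
  have "transition_system V E x y t"
    unfolding transition_system_def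
  proof (intro conjI allI impI ballI)
    show "(x, y) \<in> graph_space V E" using xy by (auto simp: cone_P_def)
    show "slack y t w u \<ge> 0" if "{w, u} \<in> E" for w u
    proof -
      have "(\<Sum>v\<in>UNIV. t w u v) \<le> y $ {w, u}" using t[of w] that by blast
      then show ?thesis by (simp add: slack_def)
    qed
    fix w assume "w \<in> V"
    then have "(\<Sum>u\<in>nbrs_in E V w. 2 * y $ {w, u} - (\<Sum>v\<in>UNIV. t w u v)) \<le> 2 * x $ w"
      using t[of w] by blast
    then show "(\<Sum>u\<in>nbrs_in E V w. y $ {w, u} + slack y t w u) \<le> 2 * x $ w"
      by (simp add: slack_def algebra_simps)
  qed (use t in blast)+
  then show thesis ..
qed

lemma transition_weight_le:
  fixes V :: "'a::finite set"
  assumes "transition_system V E x y t" "{w, u} \<in> E"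
  shows "t w u v \<le> y $ {w, u}"
proof -
  have "t w u v \<le> (\<Sum>v\<in>UNIV. t w u v)"
    using assms(1) by (intro member_le_sum) (auto simp: transition_system_def)
  moreover have "slack y t w u \<ge> 0" using assms by (auto simp: transition_system_def)
  ultimately show ?thesis by (simp add: slack_def)
qed

lemma edge_weight_nonneg:
  fixes V :: "'a::finite set"
  assumes "transition_system V E x y t" "{w, u} \<in> E"
  shows "y $ {w, u} \<ge> 0"
proof -
  have "t w u u \<ge> 0" using assms(1) unfolding transition_system_def by blast
  then show ?thesis using transition_weight_le[OF assms, of u] by linarith
qed

text \<open>Subtract the vector of \<open>U\<close>, scaled by the least transition weight or end
  slack that \<open>U\<close> uses. An entry attaining the minimum becomes zero and no zero entry
  becomes nonzero, so the count of nonzero entries drops.\<close>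

lemma transition_system_peel:
  fixes V :: "'a::finite set"
  assumes sg: "simple_graph V E" and ts: "transition_system V E x y t" and U: "U \<subseteq> V" "U \<noteq> {}"
    and pos: "\<And>w. w \<in> U \<Longrightarrow> (\<exists>u v. u \<noteq> v \<and> nbrs_in E U w = {u, v} \<and> t w u v > 0) \<or>
        (\<exists>u. nbrs_in E U w = {u} \<and> slack y t w u > 0)"
  obtains x' y' t' \<epsilon> where "transition_system V E x' y' t'" "\<epsilon> \<ge> 0"
    "(x, y) = (x', y') + \<epsilon> *\<^sub>R induced_vec E U"
    "card {(w, u, v). t' w u v \<noteq> 0} + card {(w, u). {w, u} \<in> E \<and> slack y' t' w u \<noteq> 0}
      < card {(w, u, v). t w u v \<noteq> 0} + card {(w, u). {w, u} \<in> E \<and> slack y t w u \<noteq> 0}"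
proof -
  have t0: "\<And>w u v. t w u v \<ge> 0" and tsym: "\<And>w u v. t w u v = t w v u"
    and tsupp: "\<And>w u v. t w u v \<noteq> 0 \<Longrightarrow> {w, u} \<in> E \<and> {w, v} \<in> E \<and> u \<noteq> v \<and> {u, v} \<notin> E"
    and s0: "\<And>w u. {w, u} \<in> E \<Longrightarrow> slack y t w u \<ge> 0"
    and load: "\<And>w. w \<in> V \<Longrightarrow> (\<Sum>u\<in>nbrs_in E V w. y $ {w, u} + slack y t w u) \<le> 2 * x $ w"
    and gs: "(x, y) \<in> graph_space V E"
    using ts unfolding transition_system_def by blast+
  define T where "T = {(w, u, v). w \<in> U \<and> u \<noteq> v \<and> nbrs_in E U w = {u, v}}"
  define S where "S = {(w, u). w \<in> U \<and> nbrs_in E U w = {u}}"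
  define F where "F = (\<lambda>(w, u, v). t w u v) ` T \<union> (\<lambda>(w, u). slack y t w u) ` S"
  have T: "t w u v > 0" "{w, u} \<in> E" "{w, v} \<in> E" if "(w, u, v) \<in> T" for w u v
  proof -
    have w: "w \<in> U" "u \<noteq> v" "nbrs_in E U w = {u, v}" using that by (auto simp: T_def)
    then show "t w u v > 0" using pos[OF w(1)] tsym by (auto simp: doubleton_eq_iff)
    have "u \<in> nbrs_in E U w" "v \<in> nbrs_in E U w" using w by auto
    then show "{w, u} \<in> E" "{w, v} \<in> E" by (auto simp: nbrs_in_def)
  qed
  have S: "slack y t w u > 0" "{w, u} \<in> E" if "(w, u) \<in> S" for w u
  proof -
    have w: "w \<in> U" "nbrs_in E U w = {u}" using that by (auto simp: S_def)
    then show "slack y t w u > 0" using pos[OF w(1)] by auto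
    have "u \<in> nbrs_in E U w" using w by auto
    then show "{w, u} \<in> E" by (auto simp: nbrs_in_def)
  qed
  have "F \<noteq> {}"
  proof -
    obtain w where "w \<in> U" using U by blast
    with pos[of w] have "T \<noteq> {} \<or> S \<noteq> {}" unfolding T_def S_def by blast
    then show ?thesis by (auto simp: F_def)
  qed
  moreover have finF: "finite F" by (simp add: F_def)
  moreover define \<epsilon> where "\<epsilon> = Min F"
  ultimately have \<epsilon>F: "\<epsilon> \<in> F" by simp
  have Fpos: "f > 0" if "f \<in> F" for f using that T(1) S(1) by (auto simp: F_def)
  have \<epsilon>0: "\<epsilon> > 0" using Fpos \<epsilon>F by blast
  have \<epsilon>T: "\<epsilon> \<le> t w u v" if "(w, u, v) \<in> T" for w u v
    unfolding \<epsilon>_def using that finF by (intro Min_le) (force simp: F_def)+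
  have \<epsilon>S: "\<epsilon> \<le> slack y t w u" if "(w, u) \<in> S" for w u
    unfolding \<epsilon>_def using that finF by (intro Min_le) (force simp: F_def)+
  define x' where "x' = x - \<epsilon> *\<^sub>R fst (induced_vec E U)"
  define y' where "y' = y - \<epsilon> *\<^sub>R snd (induced_vec E U)"
  define t' where "t' w u v = t w u v - (if (w, u, v) \<in> T then \<epsilon> else 0)" for w u v
  have x': "x' $ w = x $ w - (if w \<in> U then \<epsilon> else 0)" for w
    by (simp add: x'_def induced_vec_def)
  have y': "y' $ {w, u} = y $ {w, u} - (if w \<in> U \<and> u \<in> nbrs_in E U w then \<epsilon> else 0)" for w u
    by (auto simp: y'_def induced_vec_def nbrs_in_def)
  \<comment> \<open>At a vertex with two neighbours in \<open>U\<close>, the edge weight and its one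
    affected transition both drop by \<open>\<epsilon>\<close>, so the slack stays; at an end only
    the edge weight drops.\<close>
  have slack': "slack y' t' w u = slack y t w u - (if (w, u) \<in> S then \<epsilon> else 0)" for w u
  proof -
    have "(\<Sum>v\<in>UNIV. t' w u v) = (\<Sum>v\<in>UNIV. t w u v) - (\<Sum>v\<in>UNIV. if (w, u, v) \<in> T then \<epsilon> else 0)"
      by (simp add: t'_def sum_subtractf)
    moreover have "(\<Sum>v\<in>UNIV. if (w, u, v) \<in> T then \<epsilon> else 0)
        = (if w \<in> U \<and> u \<in> nbrs_in E U w then \<epsilon> else 0) - (if (w, u) \<in> S then \<epsilon> else 0)"
    proof (cases "w \<in> U \<and> u \<in> nbrs_in E U w \<and> (w, u) \<notin> S")
      case False
      then have "(w, u, v) \<notin> T" for v by (auto simp: T_def S_def)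
      moreover have "w \<in> U \<and> u \<in> nbrs_in E U w \<longleftrightarrow> (w, u) \<in> S" using False by (auto simp: S_def)
      ultimately show ?thesis by simp
    next
      case True
      then obtain a b where ab: "a \<noteq> b" "nbrs_in E U w = {a, b}" using pos[of w] by (auto simp: S_def)
      define c where "c = (if u = a then b else a)"
      have "(w, u, v) \<in> T \<longleftrightarrow> v = c" for v
        using True ab by (auto simp: T_def c_def doubleton_eq_iff)
      then show ?thesis using True by simp
    qed
    ultimately show ?thesis by (simp add: slack_def y')
  qed
  \<comment> \<open>Each vertex of \<open>U\<close> contributes twice: through two edges, or at an
    end through one edge and its slack. This matches the factor 2 in front of
    \<open>x\<close>.\<close>
  have load_diff: "(\<Sum>u\<in>nbrs_in E V w. (if u \<in> nbrs_in E U w then \<epsilon> else 0) + (if (w, u) \<in> S then \<epsilon> else 0))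
      = 2 * \<epsilon>" if w: "w \<in> U" for w
  proof -
    have sub: "nbrs_in E U w \<subseteq> nbrs_in E V w" using U by (auto simp: nbrs_in_def)
    have "(\<Sum>u\<in>nbrs_in E V w. (if u \<in> nbrs_in E U w then \<epsilon> else 0) + (if (w, u) \<in> S then \<epsilon> else 0))
      = (\<Sum>u\<in>nbrs_in E U w. \<epsilon> + (if (w, u) \<in> S then \<epsilon> else 0))"
      using sub by (intro sum.mono_neutral_cong_right) (auto simp: S_def)
    also have "\<dots> = 2 * \<epsilon>"
      using pos[OF w] w by (auto simp: S_def)
    finally show ?thesis .
  qed
  have "transition_system V E x' y' t'"
    unfolding transition_system_def
  proof (intro conjI allI impI ballI)
    show "(x', y') \<in> graph_space V E"
      using gs U by (auto simp: graph_space_def x'_def y'_def induced_vec_def)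
    show "t' w u v \<ge> 0" for w u v using t0 \<epsilon>T by (auto simp: t'_def)
    have "(w, u, v) \<in> T \<longleftrightarrow> (w, v, u) \<in> T" for w u v by (auto simp: T_def insert_commute)
    then show "t' w u v = t' w v u" for w u v using tsym by (simp add: t'_def)
    show "slack y' t' w u \<ge> 0" if "{w, u} \<in> E" for w u using s0[OF that] \<epsilon>S by (auto simp: slack')
  next
    fix w u v assume "t' w u v \<noteq> 0"
    then have "t w u v \<noteq> 0" using T(1)[of w u v] by (auto simp: t'_def split: if_splits)
    then show "{w, u} \<in> E" "{w, v} \<in> E" "u \<noteq> v" "{u, v} \<notin> E" using tsupp by blast+
  next
    fix w assume w: "w \<in> V"
    have "(\<Sum>u\<in>nbrs_in E V w. y' $ {w, u} + slack y' t' w u)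
      = (\<Sum>u\<in>nbrs_in E V w. y $ {w, u} + slack y t w u) - (if w \<in> U then 2 * \<epsilon> else 0)"
    proof (cases "w \<in> U")
      case True
      have "(\<Sum>u\<in>nbrs_in E V w. y' $ {w, u} + slack y' t' w u)
        = (\<Sum>u\<in>nbrs_in E V w. (y $ {w, u} + slack y t w u) -
          ((if u \<in> nbrs_in E U w then \<epsilon> else 0) + (if (w, u) \<in> S then \<epsilon> else 0)))"
        using True by (intro sum.cong) (simp_all add: y' slack')
      then show ?thesis using load_diff[OF True] True by (simp only: sum_subtractf if_True)
    next
      case False
      then show ?thesis by (simp add: y' slack' S_def)
    qed
    then show "(\<Sum>u\<in>nbrs_in E V w. y' $ {w, u} + slack y' t' w u) \<le> 2 * x' $ w"
      using load[OF w] by (auto simp: x')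
  qed
  moreover have "(x, y) = (x', y') + \<epsilon> *\<^sub>R induced_vec E U"
    by (simp add: x'_def y'_def prod_eq_iff)
  moreover have "card {(w, u, v). t' w u v \<noteq> 0} + card {(w, u). {w, u} \<in> E \<and> slack y' t' w u \<noteq> 0}
      < card {(w, u, v). t w u v \<noteq> 0} + card {(w, u). {w, u} \<in> E \<and> slack y t w u \<noteq> 0}"
  proof -
    have subT: "{(w, u, v). t' w u v \<noteq> 0} \<subseteq> {(w, u, v). t w u v \<noteq> 0}"
      using T(1) by (force simp: t'_def split: if_splits)
    have subS: "{(w, u). {w, u} \<in> E \<and> slack y' t' w u \<noteq> 0} \<subseteq> {(w, u). {w, u} \<in> E \<and> slack y t w u \<noteq> 0}"
      using S(1) by (force simp: slack' split: if_splits)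
    consider w u v where "(w, u, v) \<in> T" "\<epsilon> = t w u v" | w u where "(w, u) \<in> S" "\<epsilon> = slack y t w u"
      using \<epsilon>F by (auto simp: F_def)
    then show ?thesis
    proof cases
      case 1
      then have "t' w u v = 0" "t w u v \<noteq> 0" using T(1)[of w u v] by (auto simp: t'_def)
      then have "{(w, u, v). t' w u v \<noteq> 0} \<subset> {(w, u, v). t w u v \<noteq> 0}" using subT by blast
      then show ?thesis using card_mono[OF _ subS] by (intro add_less_le_mono psubset_card_mono) auto
    next
      case 2
      then have "slack y' t' w u = 0" "slack y t w u \<noteq> 0" "{w, u} \<in> E" using S[of w u] by (auto simp: slack')
      then have "{(w, u). {w, u} \<in> E \<and> slack y' t' w u \<noteq> 0} \<subset> {(w, u). {w, u} \<in> E \<and> slack y t w u \<noteq> 0}"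
        using subS by blast
      then show ?thesis using card_mono[OF _ subT] by (intro add_le_less_mono psubset_card_mono) auto
    qed
  qed
  ultimately show thesis using that \<epsilon>0 by (meson less_imp_le)
qed

section \<open>Maximal walks of positive weight\<close>

definition positive_walk ::
    "'a::finite set set \<Rightarrow> real ^ ('a set) \<Rightarrow> ('a \<Rightarrow> 'a \<Rightarrow> 'a \<Rightarrow> real) \<Rightarrow> 'a list \<Rightarrow> bool" where
  "positive_walk E y t p \<longleftrightarrow> 2 \<le> length p \<and>
     (\<forall>i. Suc i < length p \<longrightarrow> {p ! i, p ! Suc i} \<in> E \<and> y $ {p ! i, p ! Suc i} > 0) \<and>
     (\<forall>i. Suc (Suc i) < length p \<longrightarrow> t (p ! Suc i) (p ! i) (p ! Suc (Suc i)) > 0)"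

text \<open>Transitions are symmetric in their outer vertices. Reversal lets the maximality argument
  for the first vertex serve the last one too.\<close>

lemma positive_walk_rev:
  fixes V :: "'a::finite set"
  assumes ts: "transition_system V E x y t" and p: "positive_walk E y t p"
  shows "positive_walk E y t (rev p)"
  unfolding positive_walk_def
proof (intro conjI allI impI)
  let ?n = "length p"
  show "2 \<le> length (rev p)" using p by (simp add: positive_walk_def)
  fix i assume i: "Suc i < length (rev p)"
  have eq: "rev p ! i = p ! Suc (?n - Suc (Suc i))" "rev p ! Suc i = p ! (?n - Suc (Suc i))"
    using i by (simp_all add: rev_nth Suc_diff_Suc)
  have "Suc (?n - Suc (Suc i)) < ?n" using i by simp
  then show "{rev p ! i, rev p ! Suc i} \<in> E" "y $ {rev p ! i, rev p ! Suc i} > 0"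
    using p unfolding positive_walk_def eq by (metis insert_commute)+
next
  let ?n = "length p"
  fix i assume i: "Suc (Suc i) < length (rev p)"
  define k where "k = ?n - Suc (Suc (Suc i))"
  have eq: "rev p ! i = p ! Suc (Suc k)" "rev p ! Suc i = p ! Suc k" "rev p ! Suc (Suc i) = p ! k"
    using i by (simp_all add: rev_nth k_def Suc_diff_Suc)
  have "Suc (Suc k) < ?n" using i by (simp add: k_def)
  then have "t (p ! Suc k) (p ! k) (p ! Suc (Suc k)) > 0" using p unfolding positive_walk_def by blast
  then show "t (rev p ! Suc i) (rev p ! i) (rev p ! Suc (Suc i)) > 0"
    using ts unfolding eq transition_system_def by metis
qed

text \<open>A positive walk may a priori repeat vertices. But a positive transition joins distinct
  nonadjacent vertices, so consecutive triples are induced, and chordality extends this to the whole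
  walk.\<close>

lemma positive_walk_induced:
  fixes V :: "'a::finite set"
  assumes sg: "simple_graph V E" and ch: "chordal V E" and ts: "transition_system V E x y t"
    and p: "positive_walk E y t p"
  shows "induced_path V E p"
  unfolding induced_path_def
proof (intro conjI allI impI)
  have step: "{p ! i, p ! Suc i} \<in> E" if "Suc i < length p" for i
    using p that by (auto simp: positive_walk_def)
  have local: "p ! i \<noteq> p ! Suc (Suc i) \<and> {p ! i, p ! Suc (Suc i)} \<notin> E" if "Suc (Suc i) < length p" for i
  proof -
    have "t (p ! Suc i) (p ! i) (p ! Suc (Suc i)) \<noteq> 0" using p that by (force simp: positive_walk_def)
    then show ?thesis using ts unfolding transition_system_def by blast
  qed
  have far: "p ! i \<noteq> p ! j \<and> {p ! i, p ! j} \<notin> E" if "i + 2 \<le> j" "j < length p" for i j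
    using chordal_locally_induced_walk[OF sg ch step local that] .
  have less: "p ! i \<noteq> p ! j \<and> ({p ! i, p ! j} \<in> E \<longleftrightarrow> j = Suc i)" if "i < j" "j < length p" for i j
    using that step[of i] far[of i j] edge_endpoints[OF sg] by (cases "j = Suc i") auto
  show "distinct p" unfolding distinct_conv_nth using less by (metis linorder_neqE_nat)
  show "p \<noteq> []" using p by (auto simp: positive_walk_def)
  show "{p ! i, p ! j} \<in> E \<longleftrightarrow> j = Suc i \<or> i = Suc j" if "i < length p" "j < length p" for i j
    using less[of i j] less[of j i] that no_loop[OF sg]
    by (cases i j rule: linorder_cases) (auto simp: insert_commute)
  show "set p \<subseteq> V"
  proof
    fix v assume "v \<in> set p"
    then obtain i where i: "i < length p" "v = p ! i" by (metis in_set_conv_nth)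
    have len: "2 \<le> length p" using p by (simp add: positive_walk_def)
    have "\<exists>u. {v, u} \<in> E"
    proof (cases "Suc i < length p")
      case True
      then show ?thesis using step[OF True] i by blast
    next
      case False
      then have "Suc (i - 1) = i" using i len by simp
      then have "{p ! (i - 1), v} \<in> E" using step[of "i - 1"] i by simp
      then show ?thesis by (auto simp: insert_commute)
    qed
    then show "v \<in> V" using edge_endpoints[OF sg] by blast
  qed
qed

text \<open>Without slack the positive weight of the first edge is used up by transitions at
  \<open>p ! 0\<close>. One of them leads to some \<open>v\<close>, and prepending \<open>v\<close>
  gives a longer positive walk.\<close>

lemma maximal_positive_walk_slack:
  fixes V :: "'a::finite set"
  assumes ts: "transition_system V E x y t" and p: "positive_walk E y t p"
    and max: "\<And>q. positive_walk E y t q \<Longrightarrow> length q \<le> length p"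
  shows "slack y t (p ! 0) (p ! 1) > 0"
proof (rule ccontr)
  have len: "2 \<le> length p" using p by (simp add: positive_walk_def)
  then have e: "{p ! 0, p ! 1} \<in> E" "y $ {p ! 0, p ! 1} > 0"
    using p unfolding positive_walk_def by (metis One_nat_def Suc_1 Suc_le_lessD)+
  assume "\<not> slack y t (p ! 0) (p ! 1) > 0"
  then have "(\<Sum>v\<in>UNIV. t (p ! 0) (p ! 1) v) > 0" using e by (simp add: slack_def)
  then obtain v where v: "t (p ! 0) (p ! 1) v > 0"
    by (metis less_le_not_le linorder_le_less_linear sum_nonpos)
  then have tv: "t (p ! 0) v (p ! 1) > 0" "{p ! 0, v} \<in> E"
    using ts unfolding transition_system_def by (metis less_irrefl)+
  have "t (p ! 0) v (p ! 1) \<le> y $ {p ! 0, v}" using transition_weight_le[OF ts tv(2)] .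
  then have yv: "y $ {v, p ! 0} > 0" "{v, p ! 0} \<in> E" using tv by (simp_all add: insert_commute)
  have "positive_walk E y t (v # p)"
    unfolding positive_walk_def
  proof (intro conjI allI impI)
    fix i assume "Suc i < length (v # p)"
    then show "{(v # p) ! i, (v # p) ! Suc i} \<in> E" "y $ {(v # p) ! i, (v # p) ! Suc i} > 0"
      using p yv by (cases i; simp add: positive_walk_def)+
  next
    fix i assume "Suc (Suc i) < length (v # p)"
    then show "t ((v # p) ! Suc i) ((v # p) ! i) ((v # p) ! Suc (Suc i)) > 0"
      using p tv by (cases i) (simp_all add: positive_walk_def)
  qed (use len in simp)
  then show False using max by fastforce
qed

text \<open>A longest positive walk is an induced path with positive transitions inside, and
  maximality at both ends supplies the positive slack. These are the conditions for peeling it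
  off.\<close>

lemma obtain_positive_path:
  fixes V :: "'a::finite set"
  assumes sg: "simple_graph V E" and ch: "chordal V E" and ts: "transition_system V E x y t"
    and e: "{a, b} \<in> E" "y $ {a, b} > 0"
  obtains U where "U \<in> path_sets V E"
    "\<And>w. w \<in> U \<Longrightarrow> (\<exists>u v. u \<noteq> v \<and> nbrs_in E U w = {u, v} \<and> t w u v > 0) \<or>
        (\<exists>u. nbrs_in E U w = {u} \<and> slack y t w u > 0)"
proof -
  have "positive_walk E y t [a, b]" using e by (simp add: positive_walk_def)
  \<comment> \<open>Induced paths repeat no vertex, so lengths are bounded and a longest positive
    walk exists; \<open>Suc\<close> makes the bound strict.\<close>
  moreover have "length q < Suc (card (UNIV :: 'a set))" if "positive_walk E y t q" for q
    using positive_walk_induced[OF sg ch ts that] card_mono[of UNIV "set q"]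
    by (simp add: induced_path_def distinct_card)
  ultimately obtain p where p: "positive_walk E y t p"
    and max: "\<And>q. positive_walk E y t q \<Longrightarrow> length q \<le> length p"
    using ex_has_greatest_nat[of "positive_walk E y t" "[a, b]" length "Suc (card (UNIV :: 'a set))"] by blast
  let ?n = "length p"
  note ind = positive_walk_induced[OF sg ch ts p]
  have len: "2 \<le> ?n" using p by (simp add: positive_walk_def)
  have first: "slack y t (p ! 0) (p ! 1) > 0" using maximal_positive_walk_slack[OF ts p max] .
  have "slack y t (rev p ! 0) (rev p ! 1) > 0"
    using maximal_positive_walk_slack[OF ts positive_walk_rev[OF ts p]] max by simp
  then have last: "slack y t (p ! (?n - 1)) (p ! (?n - 2)) > 0"
    using len rev_nth[of 0 p] rev_nth[of 1 p] by (cases "p = []") (simp_all add: numeral_2_eq_2)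
  show thesis
  proof
    show "set p \<in> path_sets V E"
      using induced_path_in_path_sets[OF sg ind] .
    fix w assume w: "w \<in> set p"
    then obtain i where i: "i < ?n" "w = p ! i" by (metis in_set_conv_nth)
    have nb: "nbrs_in E (set p) w = (\<lambda>j. p ! j) ` {j. j < ?n \<and> (j = Suc i \<or> i = Suc j)}"
      unfolding i(2) nbrs_in_set[OF i(1)] using ind i(1)
      unfolding induced_path_def by (intro arg_cong[of _ _ "image _"]) auto
    consider "i = 0" | "i = ?n - 1" "i \<noteq> 0" | k where "i = Suc k" "Suc (Suc k) < ?n"
      using i by (cases i) force+
    then show "(\<exists>u v. u \<noteq> v \<and> nbrs_in E (set p) w = {u, v} \<and> t w u v > 0) \<or>
        (\<exists>u. nbrs_in E (set p) w = {u} \<and> slack y t w u > 0)"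
    proof cases
      case 1
      then have "{j. j < ?n \<and> (j = Suc i \<or> i = Suc j)} = {1}" using len by auto
      then show ?thesis using first nb i 1 by auto
    next
      case 2
      then have "{j. j < ?n \<and> (j = Suc i \<or> i = Suc j)} = {?n - 2}" using len by auto
      then show ?thesis using last nb i 2 by auto
    next
      case 3
      then have "{j. j < ?n \<and> (j = Suc i \<or> i = Suc j)} = {k, Suc (Suc k)}" by auto
      moreover have "t w (p ! k) (p ! Suc (Suc k)) > 0" using p 3 i by (simp add: positive_walk_def)
      moreover have "p ! k \<noteq> p ! Suc (Suc k)" using ind 3 by (simp add: induced_path_def nth_eq_iff_index_eq)
      ultimately show ?thesis using nb by auto
    qed
  qed
qed

section \<open>The polyhedron as the convex hull of path vectors\<close>

lemma convex_cone_hull_sum: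
  assumes "finite A" "\<And>a. a \<in> A \<Longrightarrow> f a \<in> convex_cone hull S"
  shows "sum f A \<in> convex_cone hull S"
  using assms
  by (induction A) (auto intro: convex_cone_hull_add convex_cone_hull_contains_0)

text \<open>Paths are peeled off as long as some edge has positive weight, the number of nonzero
  transitions and slacks decreasing each time. What remains has \<open>y = 0\<close> and is a
  nonnegative combination of vectors of single vertices.\<close>

lemma transition_system_in_hull:
  fixes V :: "'a::finite set"
  assumes sg: "simple_graph V E" and ch: "chordal V E" and "transition_system V E x y t"
  shows "(x, y) \<in> convex_cone hull (induced_vec E ` path_sets V E)"
  using assms(3)
proof (induction "card {(w, u, v). t w u v \<noteq> 0} + card {(w, u). {w, u} \<in> E \<and> slack y t w u \<noteq> 0}"
    arbitrary: x y t rule: less_induct)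
  case (less y t x)
  note ts = less.prems
  show ?case
  proof (cases "\<exists>a b. {a, b} \<in> E \<and> y $ {a, b} > 0")
    case True
    then obtain a b where "{a, b} \<in> E" "y $ {a, b} > 0" by blast
    then obtain U where U: "U \<in> path_sets V E"
      and pos: "\<And>w. w \<in> U \<Longrightarrow> (\<exists>u v. u \<noteq> v \<and> nbrs_in E U w = {u, v} \<and> t w u v > 0) \<or>
        (\<exists>u. nbrs_in E U w = {u} \<and> slack y t w u > 0)"
      using obtain_positive_path[OF sg ch ts] by blast
    have "U \<subseteq> V" "U \<noteq> {}" using U by (auto simp: path_sets_def thin_sets_def)
    then obtain x' y' t' \<epsilon> where "transition_system V E x' y' t'" and \<epsilon>: "\<epsilon> \<ge> 0"
      and xy: "(x, y) = (x', y') + \<epsilon> *\<^sub>R induced_vec E U"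
      and "card {(w, u, v). t' w u v \<noteq> 0} + card {(w, u). {w, u} \<in> E \<and> slack y' t' w u \<noteq> 0}
        < card {(w, u, v). t w u v \<noteq> 0} + card {(w, u). {w, u} \<in> E \<and> slack y t w u \<noteq> 0}"
      using transition_system_peel[OF sg ts _ _ pos] by blast
    then have "(x', y') \<in> convex_cone hull (induced_vec E ` path_sets V E)"
      using less.hyps by blast
    moreover have "induced_vec E U \<in> convex_cone hull (induced_vec E ` path_sets V E)"
      using U by (simp add: hull_inc)
    ultimately show ?thesis unfolding xy using \<epsilon>
      by (intro convex_cone_hull_add convex_cone_hull_mul)
  next
    case False
    have gs: "(x, y) \<in> graph_space V E" using ts by (simp add: transition_system_def)
    have "y $ e = 0" for e
    proof (cases "e \<in> E")
      case True
      then obtain u v where "e = {u, v}" using sg by (auto simp: simple_graph_def card_2_iff)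
      then show ?thesis using False True edge_weight_nonneg[OF ts, of u v] by force
    next
      case False
      then show ?thesis using gs by (simp add: graph_space_def)
    qed
    then have y: "y = 0" by (simp add: vec_eq_iff)
    \<comment> \<open>A transition system does not state this directly; it follows from the bound by
      \<open>2 * x $ w\<close>, whose left side is nonnegative.\<close>
    have x0: "x $ w \<ge> 0" if "w \<in> V" for w
    proof -
      have "(\<Sum>u\<in>nbrs_in E V w. y $ {w, u} + slack y t w u) \<ge> 0"
        using ts edge_weight_nonneg[OF ts] by (intro sum_nonneg add_nonneg_nonneg)
          (auto simp: transition_system_def nbrs_in_def)
      moreover have "(\<Sum>u\<in>nbrs_in E V w. y $ {w, u} + slack y t w u) \<le> 2 * x $ w"
        using ts that unfolding transition_system_def by blast
      ultimately show ?thesis by linarith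
    qed
    have vec: "induced_vec E {v} = (axis v 1, 0)" for v
    proof -
      have "\<not> (e \<in> E \<and> e \<subseteq> {v})" for e using sg by (auto simp: simple_graph_def subset_singleton_iff)
      then show ?thesis by (auto simp: induced_vec_def axis_def vec_eq_iff)
    qed
    have "(x, y) = (\<Sum>v\<in>V. x $ v *\<^sub>R induced_vec E {v})"
    proof -
      have "(\<Sum>v\<in>V. x $ v *\<^sub>R axis v 1) $ w = x $ w" for w
        using gs by (auto simp: axis_def graph_space_def if_distrib cong: if_cong)
      then show ?thesis by (simp add: vec y prod_eq_iff fst_sum snd_sum vec_eq_iff)
    qed
    also have "\<dots> \<in> convex_cone hull (induced_vec E ` path_sets V E)"
      using x0 singleton_in_path_sets[OF sg]
      by (intro convex_cone_hull_sum convex_cone_hull_mul hull_inc) auto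
    finally show ?thesis .
  qed
qed

text \<open>The linear functional \<open>f\<close> equals 1 on every path vector. A nonzero point of
  the cone is a nonnegative multiple of a point of the hull, and on the hyperplane the factor must
  be 1.\<close>

lemma graph_polyhedron_eq_hull:
  fixes V :: "'a::finite set"
  assumes sg: "simple_graph V E" and ch: "chordal V E"
  shows "graph_polyhedron V E = convex hull (induced_vec E ` path_sets V E)"
proof -
  let ?S = "induced_vec E ` path_sets V E"
  define f :: "(real ^ 'a) \<times> (real ^ ('a set)) \<Rightarrow> real"
    where "f p = (\<Sum>v\<in>V. fst p $ v) - (\<Sum>e\<in>E. snd p $ e)" for p
  have lin: "linear f"
    by (rule linearI) (simp_all add: f_def sum.distrib sum_distrib_left[symmetric] algebra_simps)
  have f1: "f p = 1" if "p \<in> convex hull ?S" for p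
  proof -
    have "f (induced_vec E U) = 1" if "U \<in> path_sets V E" for U
      using that induced_vec_sum[of U V E] by (simp add: path_sets_def thin_sets_def f_def)
    then have "?S \<subseteq> {p. f p = 1}" by blast
    moreover have "convex {p. f p = 1}"
      using lin by (auto simp: convex_def linear_add linear_cmul)
    ultimately show ?thesis using that hull_minimal by blast
  qed
  have poly: "graph_polyhedron V E = cone_P V E \<inter> {p. f p = 1}"
    by (auto simp: graph_polyhedron_def f_def)
  show ?thesis
  proof
    have "?S \<subseteq> cone_P V E"
      using induced_vec_in_cone_P[OF sg] by (auto simp: path_sets_def)
    then have "convex hull ?S \<subseteq> cone_P V E"
      using cone_P_convex_cone by (intro hull_minimal) (auto simp: convex_cone_def)
    then show "convex hull ?S \<subseteq> graph_polyhedron V E" using f1 poly by blast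
  next
    show "graph_polyhedron V E \<subseteq> convex hull ?S"
    proof
      fix p assume "p \<in> graph_polyhedron V E"
      then have p: "p \<in> cone_P V E" "f p = 1" using poly by auto
      obtain t where "transition_system V E (fst p) (snd p) t"
        using cone_P_transition_system[OF sg, of "fst p" "snd p"] p by auto
      then have "p \<in> convex_cone hull ?S"
        using transition_system_in_hull[OF sg ch] by fastforce
      \<comment> \<open>The convex cone hull consists of 0 and the nonnegative multiples of the
        convex hull. Excluding 0 also covers an empty set of generators.\<close>
      moreover have "p \<noteq> 0" using p(2) linear_0[OF lin] by auto
      ultimately obtain q c where q: "q \<in> convex hull ?S" "p = c *\<^sub>R q"
        unfolding convex_cone_hull_convex_hull by auto
      then have "c = 1" using f1[OF q(1)] p(2) linear_cmul[OF lin] by simp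
      then show "p \<in> convex hull ?S" using q by simp
    qed
  qed
qed

theorem corollary2p13:
  fixes V :: "'a::finite set" and E :: "'a set set"
  assumes "simple_graph V E"
  shows "(chordal V E \<longleftrightarrow> binary_polyhedron (graph_polyhedron V E)) \<and>
         (binary_polyhedron (graph_polyhedron V E) \<longleftrightarrow> bounded (graph_polyhedron V E))"
proof -
  have "binary_polyhedron (graph_polyhedron V E)" if "chordal V E"
  proof -
    let ?S = "induced_vec E ` path_sets V E"
    have eq: "graph_polyhedron V E = convex hull ?S"
      using graph_polyhedron_eq_hull[OF assms that] .
    have "polytope (graph_polyhedron V E)"
      unfolding eq polytope_def by (intro exI[of _ ?S]) simp
    moreover have "(\<forall>i. x $ i \<in> {0, 1}) \<and> (\<forall>j. y $ j \<in> {0, 1})"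
      if "(x, y) extreme_point_of graph_polyhedron V E" for x y
    proof -
      have "(x, y) \<in> ?S" using that unfolding eq by (rule extreme_point_of_convex_hull)
      then show ?thesis by (auto simp: induced_vec_def)
    qed
    ultimately show ?thesis unfolding binary_polyhedron_def by blast
  qed
  moreover have "bounded (graph_polyhedron V E)" if "binary_polyhedron (graph_polyhedron V E)"
    using that polytope_imp_bounded by (auto simp: binary_polyhedron_def)
  moreover have "chordal V E" if "bounded (graph_polyhedron V E)"
    using that graph_polyhedron_unbounded[OF assms] unfolding chordal_def by blast
  ultimately show ?thesis by blast
qed

end
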